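(* Let $q$ be a positive integer with $q\leq 10$. If two lens spaces, both with fundamental group of order $q$, are isospectral, then they are isometric.
   Context: $S^{2n-1}$ is the unit sphere in $\mathbb{R}^{2n}$ with the round metric of constant sectional curvature $1$. For $q\in\mathbb{N}=\{1,2,\dots\}$ and $s=(s_1,\dots,s_n)\in\mathbb{Z}^n$ with $\gcd(q,s_j)=1$ for all $1\leq j\leq n$, the lens space $L(q;s)$ is the quotient $S^{2n-1}/\Gamma_{q,s}$ with the Riemannian metric induced by the round metric, where $\Gamma_{q,s}\subset\mathrm{SO}(2n)$ is the cyclic group generated by the block-diagonal matrix $\operatorname{diag}\big(R(\tfrac{2\pi s_1}{q}),\dots,R(\tfrac{2\pi s_n}{q})\big)$, with $R(\theta)=\begin{pmatrix}\cos\theta&\sin\theta\\-\sin\theta&\cos\theta\end{pmatrix}$. The group $\Gamma_{q,s}$ has order $q$ and acts freely on $S^{2n-1}$; saying that the lens space $L(q;s)$ has fundamental group of order $q$ refers to $|\Gamma_{q,s}|=q$. The spectrum of $S^{d}/\Gamma$ ($d=2n-1$, $\Gamma\subset\mathrm{O}(d+1)$ finite) is the multiset of eigenvalues of the Laplace--Beltrami operator acting on functions. Explicitly, it consists of the numbers $\lambda_k=k(k+d-1)$, $k\geq 0$, each with multiplicity $\dim\mathcal{H}_k^\Gamma$, where $\mathcal{H}_k$ is the space of complex harmonic homogeneous polynomials of degree $k$ in $d+1$ variables, with $\mathrm{O}(d+1)$ acting by $(a\cdot P)(z)=P(a^{-1}z)$, and $\mathcal{H}_k^\Gamma$ is its subspace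 of $\Gamma$-invariant elements. Two such spaces are isospectral if their spectra coincide as multisets; isospectral ones have the same dimension. *)

theory Defs
  imports "HOL-Analysis.Analysis" "HOL-Library.Function_Algebras"
begin

section \<open>Lens spaces\<close>

text \<open>\<open>\<real>\<^bsup>2n\<^esup>\<close> is \<^typ>\<open>real^('n \<times> 2)\<close>: the index \<open>(j, a)\<close> is coordinate \<open>a\<close> of the \<open>j\<close>-th
  block.\<close>

definition rotation_matrix :: "real \<Rightarrow> real^2^2" where
  "rotation_matrix \<theta> = vector [vector [cos \<theta>, sin \<theta>], vector [- sin \<theta>, cos \<theta>]]"

definition lens_generator :: "nat \<Rightarrow> int^'n \<Rightarrow> real^('n \<times> 2)^('n \<times> 2)" where
  "lens_generator q s =
     (\<chi> u v. if fst u = fst v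
             then rotation_matrix (2 * pi * of_int (s $ fst u) / of_nat q) $ snd u $ snd v
             else 0)"

inductive_set cyclic_matrix_group :: "real^'d^'d \<Rightarrow> (real^'d^'d) set"
  for M :: "real^'d^'d" where
  one: "mat 1 \<in> cyclic_matrix_group M"
| mult: "A \<in> cyclic_matrix_group M \<Longrightarrow> A ** M \<in> cyclic_matrix_group M"
| mult_inv: "A \<in> cyclic_matrix_group M \<Longrightarrow> A ** matrix_inv M \<in> cyclic_matrix_group M"

definition lens_group :: "nat \<Rightarrow> int^'n \<Rightarrow> (real^('n \<times> 2)^('n \<times> 2)) set" where
  "lens_group q s = cyclic_matrix_group (lens_generator q s)"

text \<open>The Riemannian manifold \<open>S\<^sup>d/\<Gamma>\<close> (with \<open>d + 1 = CARD('d)\<close>) is given by the group \<open>\<Gamma>\<close>; its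
  points are the \<open>\<Gamma>\<close>-orbits on the unit sphere.\<close>

definition orbit :: "(real^'d^'d) set \<Rightarrow> real^'d \<Rightarrow> (real^'d) set" where
  "orbit \<Gamma> x = (\<lambda>A. A *v x) ` \<Gamma>"

definition sphere_quotient :: "(real^'d^'d) set \<Rightarrow> (real^'d) set set" where
  "sphere_quotient \<Gamma> = orbit \<Gamma> ` sphere 0 1"


section \<open>Isometry\<close>

fun Ck_on :: "nat \<Rightarrow> ('a::euclidean_space) set \<Rightarrow> ('a \<Rightarrow> 'b::real_normed_vector) \<Rightarrow> bool" where
  "Ck_on 0 W f \<longleftrightarrow> continuous_on W f"
| "Ck_on (Suc k) W f \<longleftrightarrow>
     (\<forall>x\<in>W. f differentiable (at x)) \<and> (\<forall>v. Ck_on k W (\<lambda>x. frechet_derivative f (at x) v))"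

definition smooth_on :: "('a::euclidean_space) set \<Rightarrow> ('a \<Rightarrow> 'b::real_normed_vector) \<Rightarrow> bool" where
  "smooth_on W f \<longleftrightarrow> open W \<and> (\<forall>k. Ck_on k W f)"

text \<open>For \<open>\<Gamma>\<close> finite and acting freely, the smooth structure and the metric of \<open>S\<^sup>d/\<Gamma>\<close> are the ones
  making the projection from the sphere a local isometry. So \<open>F\<close> between two quotients is smooth and
  pulls the metric of the target back to that of the source iff, near every point, it lifts to a
  smooth map \<open>g\<close> between the spheres whose differential preserves the inner product of tangent
  vectors. Smoothness of \<open>g\<close> on the sphere is witnessed by a smooth extension to an open set of the
  ambient space; on vectors tangent to the sphere, the derivative of the extension depends only on
  its values on the sphere.\<close>

definition preserves_metric ::
  "(real^'d^'d) set \<Rightarrow> (real^'e^'e) set \<Rightarrow> ((real^'d) set \<Rightarrow> (real^'e) set) \<Rightarrow> bool" where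
  "preserves_metric \<Gamma> \<Gamma>' F \<longleftrightarrow>
     (\<forall>x\<in>sphere 0 1. \<exists>W g. x \<in> W \<and> smooth_on W g \<and>
        (\<forall>y \<in> W \<inter> sphere 0 1.
           g y \<in> sphere 0 1 \<and>
           F (orbit \<Gamma> y) = orbit \<Gamma>' (g y) \<and>
           (\<forall>v w. v \<bullet> y = 0 \<longrightarrow> w \<bullet> y = 0 \<longrightarrow>
              frechet_derivative g (at y) v \<bullet> frechet_derivative g (at y) w = v \<bullet> w)))"

definition isometric :: "(real^'d^'d) set \<Rightarrow> (real^'e^'e) set \<Rightarrow> bool" where
  "isometric \<Gamma> \<Gamma>' \<longleftrightarrow>
     (\<exists>F. bij_betw F (sphere_quotient \<Gamma>) (sphere_quotient \<Gamma>') \<and>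
          preserves_metric \<Gamma> \<Gamma>' F \<and>
          preserves_metric \<Gamma>' \<Gamma> (inv_into (sphere_quotient \<Gamma>) F))"


section \<open>Spectrum\<close>

text \<open>Complex polynomials in \<open>d + 1\<close> variables are represented by the functions they induce on
  \<open>\<real>\<^bsup>d+1\<^esup>\<close>, which determine them.\<close>

definition fun_scale :: "complex \<Rightarrow> ('a \<Rightarrow> complex) \<Rightarrow> ('a \<Rightarrow> complex)" where
  "fun_scale c f = (\<lambda>x. c * f x)"

lemma vector_space_fun_scale: "vector_space (fun_scale :: complex \<Rightarrow> ('a \<Rightarrow> complex) \<Rightarrow> _)"
  by unfold_locales (auto simp: fun_scale_def fun_eq_iff algebra_simps)

definition monomial :: "('d \<Rightarrow> nat) \<Rightarrow> real^'d \<Rightarrow> complex" where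
  "monomial \<alpha> = (\<lambda>x. \<Prod>i\<in>UNIV. of_real (x $ i) ^ \<alpha> i)"

definition homogeneous_polys :: "nat \<Rightarrow> (real^'d \<Rightarrow> complex) set" where
  "homogeneous_polys k = module.span fun_scale {monomial \<alpha> |\<alpha>. (\<Sum>i\<in>UNIV. \<alpha> i) = k}"

definition partial_deriv :: "'d \<Rightarrow> (real^'d \<Rightarrow> complex) \<Rightarrow> (real^'d \<Rightarrow> complex)" where
  "partial_deriv i f = (\<lambda>x. frechet_derivative f (at x) (axis i 1))"

definition harmonic_polys :: "nat \<Rightarrow> (real^'d \<Rightarrow> complex) set" where
  "harmonic_polys k =
     {P \<in> homogeneous_polys k. \<forall>x. (\<Sum>i\<in>UNIV. partial_deriv i (partial_deriv i P) x) = 0}"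

definition act :: "real^'d^'d \<Rightarrow> (real^'d \<Rightarrow> complex) \<Rightarrow> (real^'d \<Rightarrow> complex)" where
  "act A P = (\<lambda>z. P (matrix_inv A *v z))"

definition invariant_harmonic_polys :: "(real^'d^'d) set \<Rightarrow> nat \<Rightarrow> (real^'d \<Rightarrow> complex) set" where
  "invariant_harmonic_polys \<Gamma> k = {P \<in> harmonic_polys k. \<forall>A\<in>\<Gamma>. act A P = P}"

text \<open>\<open>\<lambda>\<^sub>k = k (k + d - 1)\<close>, where \<open>d = CARD('d) - 1\<close>.\<close>

definition sphere_eigenvalue :: "'d itself \<Rightarrow> nat \<Rightarrow> real" where
  "sphere_eigenvalue _ k = real k * (real k + real CARD('d) - 2)"

text \<open>The spectrum is an infinite multiset, represented by its multiplicity function. The sum over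
  all \<open>k\<close> with the given eigenvalue is finite.\<close>

definition spectrum :: "(real^'d^'d) set \<Rightarrow> real \<Rightarrow> nat" where
  "spectrum \<Gamma> \<mu> =
     (\<Sum>k | sphere_eigenvalue TYPE('d) k = \<mu>.
        vector_space.dim fun_scale (invariant_harmonic_polys \<Gamma> k))"

definition isospectral :: "(real^'d^'d) set \<Rightarrow> (real^'e^'e) set \<Rightarrow> bool" where
  "isospectral \<Gamma> \<Gamma>' \<longleftrightarrow> spectrum \<Gamma> = spectrum \<Gamma>'"

end

theory Submission
  imports Defs
begin

text \<open>
  In the coordinates \<open>z\<^sub>j, cnj z\<^sub>j\<close> the group acts diagonally on monomials, and a harmonic polynomial is
  determined by its coefficients at the monomials not divisible by one chosen \<open>z\<^sub>p * cnj z\<^sub>p\<close>, which are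
  arbitrary. So the spectrum determines, for each degree, the number of invariant monomials. Their
  generating function is, up to the factor \<open>1/q\<close>, the sum over \<open>l < q\<close> of the products over \<open>j\<close> of
  \<open>1/((1 - \<zeta>\<^bsup>l s\<^sub>j\<^esup> z) (1 - \<zeta>\<^bsup>-l s\<^sub>j\<^esup> z))\<close>, with \<open>\<zeta>\<close> a primitive \<open>q\<close>-th root of unity. The \<open>l\<close>-th
  summand has at \<open>\<zeta>\<close> a pole whose order is the number of \<open>j\<close> with \<open>l s\<^sub>j \<equiv> \<plusminus>1\<close>, and leading coefficient
  a common phase times a positive real number, so the leading terms cannot cancel. For \<open>q \<le> 10\<close> the units
  modulo \<open>q\<close> up to sign form a cyclic group of order at most 3, and the maximal pole order together
  with the leading coefficient determines the multiset of the \<open>\<plusminus>s\<^sub>j\<close> up to multiplication by a unit.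
\<close>

section \<open>Forms in complex coordinates\<close>

text \<open>The two spheres are not assumed to have the same dimension, and both the eigenvalues and
  the phase of the leading coefficient depend on it; so the dimension is read off first, from the
  degrees that are multiples of \<open>q\<close>. The root zeta is the one of smallest angle: a
  factor with residue u is, at zeta, zeta times a difference of two values of 2 cos, and as cosine
  decreases on [0, pi] this is positive for every unit class other than that of 1. The negative
  value at residue 0 occurs only for l = 0, whose summand has no pole at zeta. With one class the
  dimension alone decides. With two, the largest count and the total fix the counts up to a swap,
  which is multiplication by a unit. With three, such a multiplication makes the first count
  maximal, and the other two, b and c, have a known sum; x^b y^c with x different from y is strictly
  monotone in b for fixed b + c and so identifies b. The delicate point is a tie, where several
  summands reach the maximal order and only the sum of their coefficients is known.\<close>

interpretation fn: vector_space "fun_scale :: complex \<Rightarrow> ('a \<Rightarrow> complex) \<Rightarrow> ('a \<Rightarrow> complex)"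
  by (rule vector_space_fun_scale)

text \<open>The family \<open>L\<close> is a parameter so that monomials in the real coordinates and
  in the complex ones are instances of one notion.\<close>

definition power_prod :: "('d::finite \<Rightarrow> 'a \<Rightarrow> complex) \<Rightarrow> ('d \<Rightarrow> nat) \<Rightarrow> 'a \<Rightarrow> complex" where
  "power_prod L \<alpha> x = (\<Prod>i\<in>UNIV. L i x ^ \<alpha> i)"

definition exponents :: "nat \<Rightarrow> ('d::finite \<Rightarrow> nat) set" where
  "exponents k = {\<alpha>. (\<Sum>i\<in>UNIV. \<alpha> i) = k}"

lemma finite_exponents: "finite (exponents k :: ('d::finite \<Rightarrow> nat) set)"
proof (rule finite_subset)
  show "(exponents k :: ('d \<Rightarrow> nat) set) \<subseteq> (\<Pi>\<^sub>E i\<in>UNIV. {..k})"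
    by (auto simp: exponents_def PiE_def Pi_def intro: member_le_sum)
  show "finite (\<Pi>\<^sub>E i\<in>(UNIV::'d set). {..k})"
    by (rule finite_PiE) auto
qed

lemma exponents_0: "exponents 0 = {\<lambda>_. 0}"
  by (auto simp: exponents_def)

definition power_prod_sum ::
  "('d::finite \<Rightarrow> 'a \<Rightarrow> complex) \<Rightarrow> (('d \<Rightarrow> nat) \<Rightarrow> complex) \<Rightarrow> nat \<Rightarrow> 'a \<Rightarrow> complex" where
  "power_prod_sum L c k x = (\<Sum>\<alpha>\<in>exponents k. c \<alpha> * power_prod L \<alpha> x)"

definition forms :: "('d::finite \<Rightarrow> 'a \<Rightarrow> complex) \<Rightarrow> nat \<Rightarrow> ('a \<Rightarrow> complex) set" where
  "forms L k = range (\<lambda>c. power_prod_sum L c k)"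

lemma sum_fun_scale: "(\<Sum>a\<in>A. fun_scale (c a) (f a)) = (\<lambda>x. \<Sum>a\<in>A. c a * f a x)"
proof
  show "(\<Sum>a\<in>A. fun_scale (c a) (f a)) x = (\<Sum>a\<in>A. c a * f a x)" for x
    by (induction A rule: infinite_finite_induct) (auto simp: fun_scale_def)
qed

lemma subspace_forms: "fn.subspace (forms L k)"
proof (rule fn.subspaceI)
  show "0 \<in> forms L k"
    unfolding forms_def by (rule range_eqI[of _ _ "\<lambda>_. 0"]) (auto simp: power_prod_sum_def)
  show "P + Q \<in> forms L k" if "P \<in> forms L k" "Q \<in> forms L k" for P Q
  proof -
    from that obtain c d where "P = power_prod_sum L c k" "Q = power_prod_sum L d k"
      by (auto simp: forms_def)
    then have "P + Q = power_prod_sum L (\<lambda>\<alpha>. c \<alpha> + d \<alpha>) k"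
      by (auto simp: power_prod_sum_def fun_eq_iff algebra_simps sum.distrib)
    then show ?thesis by (auto simp: forms_def)
  qed
  show "fun_scale a P \<in> forms L k" if "P \<in> forms L k" for a P
  proof -
    from that obtain c where "P = power_prod_sum L c k" by (auto simp: forms_def)
    then have "fun_scale a P = power_prod_sum L (\<lambda>\<alpha>. a * c \<alpha>) k"
      by (auto simp: power_prod_sum_def fun_eq_iff fun_scale_def sum_distrib_left mult.assoc)
    then show ?thesis by (auto simp: forms_def)
  qed
qed

lemma power_prod_in_forms:
  assumes "\<alpha> \<in> exponents k"
  shows "power_prod L \<alpha> \<in> forms L k"
proof -
  have "power_prod L \<alpha> = power_prod_sum L (\<lambda>\<beta>. if \<beta> = \<alpha> then 1 else 0) k"
    using assms
    by (intro ext) (simp add: power_prod_sum_def finite_exponents if_distrib[of "\<lambda>t. t * _"] cong: if_cong)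
  then show ?thesis by (auto simp: forms_def)
qed

lemma forms_eq_span: "forms L k = fn.span (power_prod L ` exponents k)"
proof
  show "forms L k \<subseteq> fn.span (power_prod L ` exponents k)"
  proof
    fix P assume "P \<in> forms L k"
    then obtain c where "P = power_prod_sum L c k"
      by (auto simp: forms_def)
    then have P: "P = (\<Sum>\<alpha>\<in>exponents k. fun_scale (c \<alpha>) (power_prod L \<alpha>))"
      by (auto simp: power_prod_sum_def sum_fun_scale)
    show "P \<in> fn.span (power_prod L ` exponents k)"
      unfolding P by (intro fn.span_sum fn.span_scale fn.span_base) auto
  qed
  show "fn.span (power_prod L ` exponents k) \<subseteq> forms L k"
    by (intro fn.span_minimal subspace_forms) (auto intro: power_prod_in_forms)
qed

lemma forms_mult:
  assumes "P \<in> forms L j" "Q \<in> forms L k"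
  shows "(\<lambda>x. P x * Q x) \<in> forms L (j + k)"
proof -
  obtain c where P: "P = power_prod_sum L c j" using assms by (auto simp: forms_def)
  obtain d where Q: "Q = power_prod_sum L d k" using assms by (auto simp: forms_def)
  have "(\<lambda>x. P x * Q x) =
    (\<Sum>p\<in>exponents j \<times> exponents k. fun_scale (c (fst p) * d (snd p)) (power_prod L (\<lambda>i. fst p i + snd p i)))"
    unfolding P Q power_prod_sum_def sum_fun_scale sum_product sum.cartesian_product
    by (rule ext, rule sum.cong) (auto simp: power_prod_def power_add prod.distrib)
  also have "\<dots> \<in> forms L (j + k)"
    by (intro fn.subspace_sum fn.subspace_scale subspace_forms power_prod_in_forms)
       (auto simp: exponents_def sum.distrib)
  finally show ?thesis .
qed

lemma forms_one: "(\<lambda>_. 1) \<in> forms L 0"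
  using power_prod_in_forms[of "\<lambda>_. 0" 0 L] by (simp add: power_prod_def[abs_def] exponents_0)

lemma forms_power:
  assumes "P \<in> forms L 1"
  shows "(\<lambda>x. P x ^ k) \<in> forms L k"
proof (induction k)
  case (Suc k)
  then show ?case using forms_mult[OF assms Suc.IH] by simp
qed (simp add: forms_one)

lemma power_prod_in_forms_of_linear:
  assumes "\<And>i. M i \<in> forms L 1" and "\<alpha> \<in> exponents k"
  shows "power_prod M \<alpha> \<in> forms L k"
proof -
  have "(\<lambda>x. \<Prod>i\<in>A. M i x ^ \<alpha> i) \<in> forms L (\<Sum>i\<in>A. \<alpha> i)" if "finite A" for A
    using that
  proof (induction A rule: finite_induct)
    case empty
    then show ?case by (simp add: forms_one)
  next
    case (insert i A)
    then show ?case using forms_mult[OF forms_power[OF assms(1)[of i], of "\<alpha> i"] insert.IH] by simp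
  qed
  from this[of UNIV] show ?thesis using assms(2) by (auto simp: power_prod_def[abs_def] exponents_def)
qed

text \<open>Degrees add under multiplication of forms, so a linear substitution sends monomials of
  degree k to forms of degree k; the hypotheses say that the substitution goes both ways.\<close>

lemma forms_cong_linear:
  assumes "\<And>i. M i \<in> forms L 1" and "\<And>i. L i \<in> forms M 1"
  shows "forms L k = forms M k"
proof
  show "forms L k \<subseteq> forms M k"
    unfolding forms_eq_span[of L] using assms
    by (intro fn.span_minimal subspace_forms) (auto intro: power_prod_in_forms_of_linear)
  show "forms M k \<subseteq> forms L k"
    unfolding forms_eq_span[of M] using assms
    by (intro fn.span_minimal subspace_forms) (auto intro: power_prod_in_forms_of_linear)
qed

lemma linear_in_forms: "L i \<in> forms L 1"
proof -
  have "power_prod L (\<lambda>j. if j = i then 1 else 0) = L i"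
    by (auto simp: power_prod_def fun_eq_iff if_distrib cong: if_cong)
  then show ?thesis using power_prod_in_forms[of "\<lambda>j. if j = i then 1 else 0" 1 L]
    by (simp add: exponents_def)
qed

text \<open>Indices \<open>(j, 1)\<close> and \<open>(j, 2)\<close> carry z_j and its conjugate; the
  index type is that of the real coordinates, so that the two families can be compared.\<close>

definition complex_coord :: "'n::finite \<times> 2 \<Rightarrow> real^('n \<times> 2) \<Rightarrow> complex" where
  "complex_coord i x =
     Complex (x $ (fst i, 1)) ((if snd i = 1 then 1 else -1) * x $ (fst i, 2))"

lemma homogeneous_polys_eq_forms:
  "homogeneous_polys k = (forms complex_coord k :: (real^('n::finite \<times> 2) \<Rightarrow> complex) set)"
proof -
  let ?X = "\<lambda>(i::'n \<times> 2) (x::real^('n \<times> 2)). complex_of_real (x $ i)"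
  have "monomial = power_prod ?X" by (auto simp: monomial_def power_prod_def fun_eq_iff)
  then have "homogeneous_polys k = forms ?X k"
    by (simp add: homogeneous_polys_def forms_eq_span exponents_def image_Collect)
  also have "\<dots> = forms complex_coord k"
  proof (rule forms_cong_linear)
    fix i :: "'n \<times> 2"
    have "complex_coord i = ?X (fst i, 1) + fun_scale (if snd i = 1 then \<i> else - \<i>) (?X (fst i, 2))"
      by (auto simp: complex_coord_def fun_eq_iff complex_eq_iff fun_scale_def)
    then show "complex_coord i \<in> forms ?X 1"
      using linear_in_forms[of ?X]
      by (simp only:) (intro fn.subspace_add fn.subspace_scale subspace_forms)
    obtain j a where i: "i = (j, a)" by force
    have e1: "?X (j, 1) = fun_scale (1/2) (complex_coord (j, 1) + complex_coord (j, 2))"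
      by (auto simp: complex_coord_def fun_eq_iff complex_eq_iff fun_scale_def)
    have e2: "?X (j, 2) = fun_scale (-\<i>/2) (complex_coord (j, 1) + fun_scale (-1) (complex_coord (j, 2)))"
      by (auto simp: complex_coord_def fun_eq_iff complex_eq_iff fun_scale_def)
    have "?X (j, 1) \<in> forms complex_coord 1" unfolding e1
      by (intro fn.subspace_add fn.subspace_scale subspace_forms linear_in_forms)
    moreover have "?X (j, 2) \<in> forms complex_coord 1" unfolding e2
      by (intro fn.subspace_add fn.subspace_scale subspace_forms linear_in_forms)
    ultimately show "?X i \<in> forms complex_coord 1"
      using exhaust_2[of a] i by auto
  qed
  finally show ?thesis .
qed

section \<open>Formal Wirtinger derivatives acting on coefficient functions\<close>

definition coeff_deriv :: "'d \<Rightarrow> (('d \<Rightarrow> nat) \<Rightarrow> complex) \<Rightarrow> ('d \<Rightarrow> nat) \<Rightarrow> complex" where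
  "coeff_deriv i c \<beta> = of_nat (\<beta> i + 1) * c (\<beta>(i := \<beta> i + 1))"

lemma linear_complex_coord: "bounded_linear (complex_coord i)"
  unfolding linear_conv_bounded_linear[symmetric]
  by (rule linearI) (auto simp: complex_coord_def complex_eq_iff algebra_simps)

lemma has_derivative_power_prod:
  "(power_prod complex_coord \<alpha> has_derivative
     (\<lambda>v. \<Sum>i\<in>UNIV. of_nat (\<alpha> i) * complex_coord i v * power_prod complex_coord (\<alpha>(i := \<alpha> i - 1)) x)) (at x)"
proof -
  have "((\<lambda>x. complex_coord i x ^ \<alpha> i) has_derivative
     (\<lambda>v. of_nat (\<alpha> i) * complex_coord i v * complex_coord i x ^ (\<alpha> i - 1))) (at x)" for i :: "'a \<times> 2"
    using has_derivative_power[OF bounded_linear_imp_has_derivative[OF linear_complex_coord[of i]], of "\<alpha> i" x UNIV]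
    by (simp add: mult_ac)
  from has_derivative_prod[of UNIV "\<lambda>i x. complex_coord i x ^ \<alpha> i", OF this]
  have "(power_prod complex_coord \<alpha> has_derivative
     (\<lambda>v. \<Sum>i\<in>UNIV. of_nat (\<alpha> i) * complex_coord i v * complex_coord i x ^ (\<alpha> i - 1) *
        (\<Prod>j\<in>UNIV - {i}. complex_coord j x ^ \<alpha> j))) (at x)"
    by (simp add: power_prod_def[abs_def])
  moreover have "power_prod complex_coord (\<alpha>(i := \<alpha> i - 1)) x =
      complex_coord i x ^ (\<alpha> i - 1) * (\<Prod>j\<in>UNIV - {i}. complex_coord j x ^ \<alpha> j)" for i
    unfolding power_prod_def by (subst prod.remove[of _ i]) auto
  ultimately show ?thesis by (simp add: mult.assoc)
qed

lemma sum_fun_upd_UNIV: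
  fixes \<alpha> :: "'d::finite \<Rightarrow> nat"
  shows "(\<Sum>j\<in>UNIV. (\<alpha>(i := m)) j) + \<alpha> i = (\<Sum>j\<in>UNIV. \<alpha> j) + m"
proof -
  have "(\<Sum>j\<in>UNIV. (\<alpha>(i := m)) j) = m + (\<Sum>j\<in>UNIV - {i}. \<alpha> j)"
    by (subst sum.remove[of _ i]) auto
  moreover have "(\<Sum>j\<in>UNIV. \<alpha> j) = \<alpha> i + (\<Sum>j\<in>UNIV - {i}. \<alpha> j)"
    by (subst sum.remove[of _ i]) auto
  ultimately show ?thesis by simp
qed

lemma fun_upd_Suc_in_exponents [simp]:
  "\<beta>(i := Suc (\<beta> i)) \<in> exponents (Suc k) \<longleftrightarrow> \<beta> \<in> exponents k"
  using sum_fun_upd_UNIV[of \<beta> i "Suc (\<beta> i)"] by (auto simp: exponents_def)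

lemma fun_upd_pred_in_exponents:
  "\<alpha> \<in> exponents (Suc k) \<Longrightarrow> \<alpha> i > 0 \<Longrightarrow> \<alpha>(i := \<alpha> i - 1) \<in> exponents k"
  using sum_fun_upd_UNIV[of \<alpha> i "\<alpha> i - 1"] by (auto simp: exponents_def)

lemma sum_coeff_deriv:
  "(\<Sum>\<alpha>\<in>exponents (Suc k). c \<alpha> * (of_nat (\<alpha> i) * power_prod L (\<alpha>(i := \<alpha> i - 1)) x)) =
     power_prod_sum L (coeff_deriv i c) k x"
proof -
  have "(\<Sum>\<alpha>\<in>exponents (Suc k). c \<alpha> * (of_nat (\<alpha> i) * power_prod L (\<alpha>(i := \<alpha> i - 1)) x)) =
    (\<Sum>\<alpha> | \<alpha> \<in> exponents (Suc k) \<and> \<alpha> i > 0. c \<alpha> * (of_nat (\<alpha> i) * power_prod L (\<alpha>(i := \<alpha> i - 1)) x))"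
    by (rule sum.mono_neutral_right) (auto simp: finite_exponents)
  also have "\<dots> = power_prod_sum L (coeff_deriv i c) k x"
    unfolding power_prod_sum_def
    by (rule sum.reindex_bij_witness[where i = "\<lambda>\<beta>. \<beta>(i := Suc (\<beta> i))" and j = "\<lambda>\<alpha>. \<alpha>(i := \<alpha> i - 1)"])
       (auto simp: coeff_deriv_def fun_upd_pred_in_exponents[unfolded One_nat_def] mult_ac)
  finally show ?thesis .
qed

lemma has_derivative_power_prod_sum:
  "(power_prod_sum complex_coord c (Suc k) has_derivative
     (\<lambda>v. \<Sum>i\<in>UNIV. complex_coord i v * power_prod_sum complex_coord (coeff_deriv i c) k x)) (at x)"
proof -
  let ?d = "\<lambda>\<alpha> v. \<Sum>i\<in>UNIV. of_nat (\<alpha> i) * complex_coord i v * power_prod complex_coord (\<alpha>(i := \<alpha> i - 1)) x"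
  have "(power_prod_sum complex_coord c (Suc k) has_derivative
     (\<lambda>v. \<Sum>\<alpha>\<in>exponents (Suc k). c \<alpha> * ?d \<alpha> v)) (at x)"
    unfolding power_prod_sum_def[abs_def]
    by (intro has_derivative_sum has_derivative_mult_right has_derivative_power_prod)
  moreover have "(\<Sum>\<alpha>\<in>exponents (Suc k). c \<alpha> * ?d \<alpha> v) =
      (\<Sum>i\<in>UNIV. complex_coord i v * power_prod_sum complex_coord (coeff_deriv i c) k x)" for v
    unfolding sum_coeff_deriv[symmetric] sum_distrib_left
    by (subst sum.swap) (auto intro!: sum.cong)
  ultimately show ?thesis by simp
qed

lemma partial_deriv_power_prod_sum:
  "partial_deriv p (power_prod_sum complex_coord c (Suc k)) =
     power_prod_sum complex_coord (\<lambda>\<beta>. \<Sum>i\<in>UNIV. complex_coord i (axis p 1) * coeff_deriv i c \<beta>) k"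
proof
  fix x
  have "partial_deriv p (power_prod_sum complex_coord c (Suc k)) x =
    (\<Sum>i\<in>UNIV. complex_coord i (axis p 1) * power_prod_sum complex_coord (coeff_deriv i c) k x)"
    unfolding partial_deriv_def frechet_derivative_at[OF has_derivative_power_prod_sum, symmetric] ..
  also have "\<dots> = power_prod_sum complex_coord (\<lambda>\<beta>. \<Sum>i\<in>UNIV. complex_coord i (axis p 1) * coeff_deriv i c \<beta>) k x"
    unfolding power_prod_sum_def sum_distrib_left sum_distrib_right
    by (subst sum.swap) (auto intro!: sum.cong)
  finally show "partial_deriv p (power_prod_sum complex_coord c (Suc k)) x =
    power_prod_sum complex_coord (\<lambda>\<beta>. \<Sum>i\<in>UNIV. complex_coord i (axis p 1) * coeff_deriv i c \<beta>) k x" .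
qed

lemma sum_UNIV_times_2:
  fixes f :: "'n::finite \<times> 2 \<Rightarrow> 'b::comm_monoid_add"
  shows "(\<Sum>i\<in>UNIV. f i) = (\<Sum>j\<in>UNIV. f (j, 1) + f (j, 2))"
  unfolding UNIV_Times_UNIV[symmetric] sum.cartesian_product' by (simp add: sum_2)

lemma prod_UNIV_times_2:
  fixes f :: "'n::finite \<times> 2 \<Rightarrow> 'b::comm_monoid_mult"
  shows "(\<Prod>i\<in>UNIV. f i) = (\<Prod>j\<in>UNIV. f (j, 1) * f (j, 2))"
  unfolding UNIV_Times_UNIV[symmetric] prod.cartesian_product' by (simp add: UNIV_2)

text \<open>Wirtinger relations: d/dx = d/dz + d/dzbar and d/dy = i (d/dz - d/dzbar) in block j.
  Together they determine both complex derivatives.\<close>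

lemma sum_complex_coord_axis:
  "(\<Sum>i\<in>UNIV. complex_coord i (axis (j, 1) 1) * f i) = f (j, 1) + f (j, 2)"
  "(\<Sum>i\<in>UNIV. complex_coord i (axis (j, 2) 1) * f i) = \<i> * (f (j, 1) - f (j, 2))"
proof -
  have z: "Complex 0 0 = 0" "Complex 1 0 = 1" by (auto simp: complex_eq_iff)
  have "complex_coord (l, a) (axis (j, 1) 1) = (if l = j then 1 else 0)" for l and a :: 2
    by (auto simp: complex_coord_def axis_def z)
  then show "(\<Sum>i\<in>UNIV. complex_coord i (axis (j, 1) 1) * f i) = f (j, 1) + f (j, 2)"
    by (simp add: sum_UNIV_times_2 distrib_left[symmetric] sum.distrib if_distrib[of "\<lambda>t. t * _"] cong: if_cong)
  have "complex_coord (l, a) (axis (j, 2) 1) = (if l = j then if a = 1 then \<i> else - \<i> else 0)" for l and a :: 2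
    by (auto simp: complex_coord_def axis_def complex_eq_iff)
  then have "(\<Sum>i\<in>UNIV. complex_coord i (axis (j, 2) 1) * f i) =
      (\<Sum>l\<in>UNIV. if l = j then \<i> * (f (l, 1) - f (l, 2)) else 0)"
    by (subst sum_UNIV_times_2) (rule sum.cong, auto simp: algebra_simps)
  then show "(\<Sum>i\<in>UNIV. complex_coord i (axis (j, 2) 1) * f i) = \<i> * (f (j, 1) - f (j, 2))" by simp
qed

text \<open>Induction on the degree: a vanishing form has vanishing real derivatives, hence
  vanishing Wirtinger derivatives, and every coefficient of positive degree occurs in one of these
  up to a nonzero factor.\<close>

lemma power_prod_sum_eq_zero_iff:
  "power_prod_sum complex_coord c k = (\<lambda>_. 0) \<longleftrightarrow> (\<forall>\<alpha>\<in>exponents k. c \<alpha> = 0)"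
proof
  show "power_prod_sum complex_coord c k = (\<lambda>_. 0) \<Longrightarrow> \<forall>\<alpha>\<in>exponents k. c \<alpha> = 0"
  proof (induction k arbitrary: c)
    case 0
    then show ?case by (auto simp: power_prod_sum_def exponents_0 power_prod_def fun_eq_iff)
  next
    case (Suc k)
    let ?f = "\<lambda>x i. power_prod_sum complex_coord (coeff_deriv i c) k x"
    have zero: "(\<Sum>i\<in>UNIV. complex_coord i v * ?f x i) = 0" for x v
    proof -
      have "((\<lambda>_. 0) has_derivative (\<lambda>v. \<Sum>i\<in>UNIV. complex_coord i v * ?f x i)) (at x)"
        using has_derivative_power_prod_sum[of c k x] by (simp only: Suc.prems)
      from has_derivative_unique[OF this has_derivative_const]
      show ?thesis by (auto simp: fun_eq_iff)
    qed
    have "?f x (j, a) = 0" for x j a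
      using zero[where x=x and v="axis (j, 1) 1"] zero[where x=x and v="axis (j, 2) 1"] exhaust_2[of a]
      unfolding sum_complex_coord_axis by auto
    then have "coeff_deriv i c \<beta> = 0" if "\<beta> \<in> exponents k" for i \<beta>
      using Suc.IH[of "coeff_deriv i c"] that by (cases i) (auto simp: fun_eq_iff)
    then have *: "c (\<beta>(i := Suc (\<beta> i))) = 0" if "\<beta> \<in> exponents k" for i \<beta>
      using that by (fastforce simp: coeff_deriv_def simp del: of_nat_Suc)
    show ?case
    proof
      fix \<alpha> :: "'a \<times> 2 \<Rightarrow> nat" assume \<alpha>: "\<alpha> \<in> exponents (Suc k)"
      then have "\<exists>i. \<alpha> i > 0"
        by (metis (mono_tags, lifting) exponents_def gr0I mem_Collect_eq nat.simps(3) sum.neutral)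
      then obtain i where i: "\<alpha> i > 0" by blast
      from *[OF fun_upd_pred_in_exponents[OF \<alpha> i], of i] show "c \<alpha> = 0"
        using i by (simp add: fun_upd_idem)
    qed
  qed
qed (auto simp: power_prod_sum_def)

lemma power_prod_sum_eq_iff:
  "power_prod_sum complex_coord c k = power_prod_sum complex_coord d k \<longleftrightarrow> (\<forall>\<alpha>\<in>exponents k. c \<alpha> = d \<alpha>)"
proof -
  have "power_prod_sum complex_coord c k = power_prod_sum complex_coord d k \<longleftrightarrow>
      power_prod_sum complex_coord (\<lambda>\<alpha>. c \<alpha> - d \<alpha>) k = (\<lambda>_. 0)"
    by (simp add: power_prod_sum_def fun_eq_iff left_diff_distrib sum_subtractf)
  then show ?thesis by (simp add: power_prod_sum_eq_zero_iff)
qed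

text \<open>Multiplication by z_j * cnj z_j, on exponents.\<close>

definition raise_pair :: "'n \<Rightarrow> ('n \<times> 2 \<Rightarrow> nat) \<Rightarrow> 'n \<times> 2 \<Rightarrow> nat" where
  "raise_pair j \<beta> = \<beta>((j, 1) := \<beta> (j, 1) + 1, (j, 2) := \<beta> (j, 2) + 1)"

text \<open>The Laplacian is 4 times the sum over j of d/dz_j d/dzbar_j; this is its action on
  coefficients without the factor 4.\<close>

definition coeff_laplacian :: "(('n::finite \<times> 2 \<Rightarrow> nat) \<Rightarrow> complex) \<Rightarrow> ('n \<times> 2 \<Rightarrow> nat) \<Rightarrow> complex" where
  "coeff_laplacian c \<beta> =
     (\<Sum>j\<in>UNIV. of_nat ((\<beta> (j, 1) + 1) * (\<beta> (j, 2) + 1)) * c (raise_pair j \<beta>))"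

lemma laplacian_power_prod_sum:
  "(\<Sum>p\<in>UNIV. partial_deriv p (partial_deriv p (power_prod_sum complex_coord c (Suc (Suc k)))) x) =
     power_prod_sum complex_coord (\<lambda>\<beta>. 4 * coeff_laplacian c \<beta>) k x"
proof -
  let ?D = "\<lambda>p c \<beta>. \<Sum>i\<in>UNIV. complex_coord i (axis p 1) * coeff_deriv i c \<beta>"
  have pair: "?D (j, 1) (?D (j, 1) c) \<beta> + ?D (j, 2) (?D (j, 2) c) \<beta> =
      4 * of_nat ((\<beta> (j, 1) + 1) * (\<beta> (j, 2) + 1)) * c (raise_pair j \<beta>)" for j \<beta>
    unfolding sum_complex_coord_axis
    by (simp add: coeff_deriv_def raise_pair_def algebra_simps fun_upd_twist)
  have "(\<Sum>p\<in>UNIV. partial_deriv p (partial_deriv p (power_prod_sum complex_coord c (Suc (Suc k)))) x) =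
      (\<Sum>p\<in>UNIV. power_prod_sum complex_coord (?D p (?D p c)) k x)"
    by (simp only: partial_deriv_power_prod_sum)
  also have "\<dots> = power_prod_sum complex_coord (\<lambda>\<beta>. \<Sum>p\<in>UNIV. ?D p (?D p c) \<beta>) k x"
    unfolding power_prod_sum_def by (subst sum.swap) (simp only: sum_distrib_right)
  also have "(\<lambda>\<beta>. \<Sum>p\<in>UNIV. ?D p (?D p c) \<beta>) = (\<lambda>\<beta>. 4 * coeff_laplacian c \<beta>)"
  proof
    show "(\<Sum>p\<in>UNIV. ?D p (?D p c) \<beta>) = 4 * coeff_laplacian c \<beta>" for \<beta>
      unfolding sum_UNIV_times_2[of "\<lambda>p. ?D p (?D p c) \<beta>"] pair coeff_laplacian_def sum_distrib_left
      by (simp only: mult.assoc)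
  qed
  finally show ?thesis .
qed

lemma partial_deriv_power_prod_sum_0: "partial_deriv p (power_prod_sum complex_coord c 0) = (\<lambda>_. 0)"
  by (auto simp: partial_deriv_def power_prod_sum_def[abs_def] exponents_0 power_prod_def fun_eq_iff)

lemma partial_deriv_const: "partial_deriv p (\<lambda>_. a) = (\<lambda>_. 0)"
  by (auto simp: partial_deriv_def fun_eq_iff)

text \<open>With \<open>+ 2 = k\<close> the condition is vacuous in degrees 0 and 1, where every
  form is harmonic.\<close>

lemma power_prod_sum_in_harmonic_polys_iff:
  "power_prod_sum complex_coord c k \<in> harmonic_polys k \<longleftrightarrow>
     (\<forall>\<beta>. (\<Sum>i\<in>UNIV. \<beta> i) + 2 = k \<longrightarrow> coeff_laplacian c \<beta> = 0)"
proof -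
  have "power_prod_sum complex_coord c k \<in> homogeneous_polys k"
    by (simp add: homogeneous_polys_eq_forms forms_def)
  then have *: "power_prod_sum complex_coord c k \<in> harmonic_polys k \<longleftrightarrow>
    (\<forall>x. (\<Sum>p\<in>UNIV. partial_deriv p (partial_deriv p (power_prod_sum complex_coord c k)) x) = 0)"
    by (simp add: harmonic_polys_def)
  consider "k = 0" | "k = 1" | m where "k = Suc (Suc m)"
    by (metis One_nat_def not0_implies_Suc)
  then show ?thesis
  proof cases
    case 1
    show ?thesis unfolding * unfolding 1 by (simp add: partial_deriv_power_prod_sum_0 partial_deriv_const)
  next
    case 2
    show ?thesis unfolding * unfolding 2 One_nat_def partial_deriv_power_prod_sum partial_deriv_power_prod_sum_0 by simp
  next
    case 3
    then have "power_prod_sum complex_coord c k \<in> harmonic_polys k \<longleftrightarrow>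
        power_prod_sum complex_coord (\<lambda>\<beta>. 4 * coeff_laplacian c \<beta>) m = (\<lambda>_. 0)"
      unfolding * unfolding 3 laplacian_power_prod_sum by (simp only: fun_eq_iff)
    then show ?thesis using 3 by (simp add: power_prod_sum_eq_zero_iff exponents_def)
  qed
qed

section \<open>Invariant harmonic polynomials\<close>

text \<open>The generator multiplies the monomial of weight w by
  \<open>cis (- 2 * pi * w / q)\<close>; the difference of exponents appears because z_j and its
  conjugate rotate in opposite directions.\<close>

definition weight :: "int^'n \<Rightarrow> ('n \<times> 2 \<Rightarrow> nat) \<Rightarrow> int" where
  "weight s \<alpha> = (\<Sum>j\<in>UNIV. s $ j * (int (\<alpha> (j, 1)) - int (\<alpha> (j, 2))))"

definition weighted_exponents :: "nat \<Rightarrow> int^'n \<Rightarrow> nat \<Rightarrow> ('n \<times> 2 \<Rightarrow> nat) set" where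
  "weighted_exponents q s k = {\<alpha> \<in> exponents k. int q dvd weight s \<alpha>}"

text \<open>These index a basis of the invariant harmonic polynomials; the block \<open>p\<close> is
  an arbitrary choice.\<close>

definition reduced_exponents :: "nat \<Rightarrow> int^'n \<Rightarrow> 'n \<Rightarrow> nat \<Rightarrow> ('n \<times> 2 \<Rightarrow> nat) set" where
  "reduced_exponents q s p k = {\<alpha> \<in> weighted_exponents q s k. \<alpha> (p, 1) = 0 \<or> \<alpha> (p, 2) = 0}"

section \<open>The diagonal action of the lens group on monomials in complex coordinates\<close>

lemma lens_generator_nth:
  "lens_generator q s $ (i, a) $ (j, b) =
     (if i = j then rotation_matrix (2 * pi * of_int (s $ i) / of_nat q) $ a $ b else 0)"
  by (simp add: lens_generator_def)

lemma rotation_matrix_nth [simp]: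
  "rotation_matrix \<theta> $ 1 $ 1 = cos \<theta>" "rotation_matrix \<theta> $ 1 $ 2 = sin \<theta>"
  "rotation_matrix \<theta> $ 2 $ 1 = - sin \<theta>" "rotation_matrix \<theta> $ 2 $ 2 = cos \<theta>"
  by (simp_all add: rotation_matrix_def)

lemma lens_generator_mult_vec:
  fixes s :: "int^'n" and q :: nat
  defines "\<theta> \<equiv> \<lambda>j. 2 * pi * of_int (s $ j) / of_nat q"
  shows "(lens_generator q s *v x) $ (j, 1) = cos (\<theta> j) * x $ (j, 1) + sin (\<theta> j) * x $ (j, 2)"
    and "(lens_generator q s *v x) $ (j, 2) = - sin (\<theta> j) * x $ (j, 1) + cos (\<theta> j) * x $ (j, 2)"
proof -
  have *: "(\<Sum>l\<in>UNIV. (if j = l then u else 0) * f l + (if j = l then v else 0) * g l) = u * f j + v * g j"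
    for u v :: real and f g :: "'n \<Rightarrow> real"
    by (simp add: sum.distrib if_distrib[of "\<lambda>t. t * _"] cong: if_cong)
  show "(lens_generator q s *v x) $ (j, 1) = cos (\<theta> j) * x $ (j, 1) + sin (\<theta> j) * x $ (j, 2)"
    and "(lens_generator q s *v x) $ (j, 2) = - sin (\<theta> j) * x $ (j, 1) + cos (\<theta> j) * x $ (j, 2)"
    by (simp_all only: matrix_vector_mult_def vec_lambda_beta sum_UNIV_times_2 lens_generator_nth
          rotation_matrix_nth * \<theta>_def)
qed

lemma lens_generator_0: "lens_generator q 0 = mat 1"
proof -
  have "lens_generator q 0 *v x = x" for x :: "real^('a \<times> 2)"
  proof (rule vec_eq_iff[THEN iffD2], rule allI)
    fix i :: "'a \<times> 2"
    show "(lens_generator q 0 *v x) $ i = x $ i"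
      using exhaust_2[of "snd i"] by (cases i) (auto simp: lens_generator_mult_vec)
  qed
  then show ?thesis by (simp add: matrix_eq)
qed

lemma lens_generator_add: "lens_generator q s ** lens_generator q t = lens_generator q (s + t)"
proof -
  have "lens_generator q s *v (lens_generator q t *v x) = lens_generator q (s + t) *v x"
    for x :: "real^('a \<times> 2)"
  proof (rule vec_eq_iff[THEN iffD2], rule allI)
    fix i :: "'a \<times> 2"
    show "(lens_generator q s *v (lens_generator q t *v x)) $ i = (lens_generator q (s + t) *v x) $ i"
      using exhaust_2[of "snd i"]
      by (cases i) (auto simp: lens_generator_mult_vec add_divide_distrib distrib_left cos_add sin_add algebra_simps)
  qed
  then show ?thesis by (simp add: matrix_eq matrix_vector_mul_assoc[symmetric])
qed

lemma matrix_inv_eqI: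
  fixes A :: "'a::semiring_1^'n^'m"
  assumes "A ** B = mat 1" and "B ** A = mat 1"
  shows "matrix_inv A = B"
proof -
  have "A ** matrix_inv A = mat 1"
    unfolding matrix_inv_def by (rule someI2[of _ B]) (use assms in auto)
  then have "B ** A ** matrix_inv A = B" by (simp add: matrix_mul_assoc[symmetric])
  then show ?thesis by (simp add: assms(2))
qed

lemma matrix_inv_lens_generator: "matrix_inv (lens_generator q s) = lens_generator q (- s)"
  by (rule matrix_inv_eqI) (simp_all add: lens_generator_add lens_generator_0)

lemma lens_generator_cong:
  assumes "\<And>j. int q dvd s $ j - t $ j" "q > 0"
  shows "lens_generator q s = lens_generator q t"
proof -
  have "rotation_matrix (2 * pi * of_int (s $ j) / of_nat q) =
      rotation_matrix (2 * pi * of_int (t $ j) / of_nat q)" for j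
  proof -
    obtain m where "s $ j = t $ j + int q * m"
      using assms(1)[of j] by (metis dvd_def add_diff_cancel_left' diff_add_cancel add.commute)
    then have "2 * pi * of_int (s $ j) / of_nat q = 2 * pi * of_int (t $ j) / of_nat q + 2 * pi * of_int m"
      using assms(2) by (simp add: field_simps)
    then show ?thesis
      by (simp only: rotation_matrix_def cos_add sin_add cos_int_2pin sin_int_2pin) simp
  qed
  then show ?thesis by (simp add: lens_generator_def cong: if_cong)
qed

text \<open>By angle addition, adding parameter vectors corresponds to multiplying matrices. So
  powers of the generator, negative ones included, are the matrices with rescaled
  parameters.\<close>

lemma lens_group_eq: "lens_group q s = range (\<lambda>k::int. lens_generator q (\<chi> j. k * s $ j))"
proof
  have minus: "(\<chi> j. k * s $ j) - s = (\<chi> j. (k - 1) * s $ j)" for k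
    by (simp add: vec_eq_iff algebra_simps)
  have plus: "(\<chi> j. k * s $ j) + s = (\<chi> j. (k + 1) * s $ j)" for k
    by (simp add: vec_eq_iff algebra_simps)
  have zero: "(\<chi> j. 0 * s $ j) = 0" by (simp add: vec_eq_iff)
  show "lens_group q s \<subseteq> range (\<lambda>k::int. lens_generator q (\<chi> j. k * s $ j))"
  proof
    fix A assume "A \<in> lens_group q s"
    then show "A \<in> range (\<lambda>k::int. lens_generator q (\<chi> j. k * s $ j))"
      unfolding lens_group_def
    proof induction
      case one
      then show ?case by (metis (no_types) zero lens_generator_0 rangeI)
    next
      case (mult A)
      then show ?case by (auto simp: lens_generator_add plus)
    next
      case (mult_inv A)
      then show ?case by (auto simp: matrix_inv_lens_generator lens_generator_add minus)
    qed
  qed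
  have "lens_generator q (\<chi> j. k * s $ j) \<in> lens_group q s" for k :: int
    unfolding lens_group_def
  proof (induction k rule: int_induct[of _ 0])
    case base
    then show ?case using cyclic_matrix_group.one zero lens_generator_0 by metis
  next
    case (step1 k)
    from cyclic_matrix_group.mult[OF step1(2)] show ?case by (simp add: lens_generator_add plus)
  next
    case (step2 k)
    from cyclic_matrix_group.mult_inv[OF step2(2)] show ?case
      by (simp add: matrix_inv_lens_generator lens_generator_add minus)
  qed
  then show "range (\<lambda>k::int. lens_generator q (\<chi> j. k * s $ j)) \<subseteq> lens_group q s" by blast
qed

lemma complex_coord_lens_generator:
  "complex_coord (j, a) (lens_generator q s *v x) =
     cis ((if a = 1 then -1 else 1) * (2 * pi * of_int (s $ j) / of_nat q)) * complex_coord (j, a) x"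
  by (auto simp: complex_coord_def lens_generator_mult_vec complex_eq_iff algebra_simps)

lemma prod_cis: "(\<Prod>j\<in>A. cis (f j)) = cis (\<Sum>j\<in>A. f j)"
  by (induction A rule: infinite_finite_induct) (auto simp: cis_mult)

lemma power_prod_lens_generator:
  "power_prod complex_coord \<alpha> (lens_generator q s *v x) =
     cis (- 2 * pi * of_int (weight s \<alpha>) / of_nat q) * power_prod complex_coord \<alpha> x"
proof -
  let ?\<theta> = "\<lambda>j. 2 * pi * of_int (s $ j) / of_nat q"
  have cis: "cis (-1 * \<phi>) ^ a * cis (1 * \<phi>) ^ b = cis (- (\<phi> * (real a - real b)))" for a b \<phi>
    by (simp only: Complex.DeMoivre cis_mult) (rule arg_cong[of _ _ cis], simp add: algebra_simps)
  have "complex_coord (j, 1) (lens_generator q s *v x) ^ \<alpha> (j, 1) *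
      complex_coord (j, 2) (lens_generator q s *v x) ^ \<alpha> (j, 2) =
      cis (- (?\<theta> j * (real (\<alpha> (j, 1)) - real (\<alpha> (j, 2))))) *
      (complex_coord (j, 1) x ^ \<alpha> (j, 1) * complex_coord (j, 2) x ^ \<alpha> (j, 2))" for j
    unfolding cis[symmetric] complex_coord_lens_generator power_mult_distrib by (simp add: mult_ac)
  then have "power_prod complex_coord \<alpha> (lens_generator q s *v x) =
     (\<Prod>j\<in>UNIV. cis (- (?\<theta> j * (real (\<alpha> (j, 1)) - real (\<alpha> (j, 2)))))) * power_prod complex_coord \<alpha> x"
    unfolding power_prod_def prod_UNIV_times_2 prod.distrib[symmetric] by (rule prod.cong[OF refl])
  also have "(\<Prod>j\<in>UNIV. cis (- (?\<theta> j * (real (\<alpha> (j, 1)) - real (\<alpha> (j, 2)))))) =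
     cis (- 2 * pi * of_int (weight s \<alpha>) / of_nat q)"
    unfolding prod_cis weight_def of_int_sum sum_distrib_left sum_divide_distrib
    by (rule arg_cong[of _ _ cis], rule sum.cong) (simp_all add: algebra_simps diff_divide_distrib)
  finally show ?thesis .
qed

lemma cis_eq_1_iff_dvd:
  assumes "q > 0"
  shows "cis (2 * pi * of_int w / of_nat q) = 1 \<longleftrightarrow> int q dvd w"
proof
  assume "cis (2 * pi * of_int w / of_nat q) = 1"
  then have "cos (2 * pi * of_int w / of_nat q) = 1" by (simp add: complex_eq_iff)
  then obtain m :: int where "2 * pi * of_int w / of_nat q = of_int m * 2 * pi"
    by (auto simp: cos_one_2pi_int)
  then have "real_of_int w = of_int (m * int q)" using assms by (simp add: field_simps)
  then show "int q dvd w" by (simp only: of_int_eq_iff) simp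
next
  assume "int q dvd w"
  then obtain m where "w = int q * m" by blast
  then have "2 * pi * of_int w / of_nat q = 2 * pi * of_int m" using assms by simp
  then show "cis (2 * pi * of_int w / of_nat q) = 1" by (simp add: complex_eq_iff)
qed

lemma weight_scale: "weight (\<chi> j. k * s $ j) \<alpha> = k * weight s \<alpha>"
  by (simp add: weight_def sum_distrib_left mult.assoc)

lemma act_lens_generator:
  "act (lens_generator q s) (power_prod_sum complex_coord c k) =
     power_prod_sum complex_coord (\<lambda>\<alpha>. c \<alpha> * cis (2 * pi * of_int (weight s \<alpha>) / of_nat q)) k"
proof -
  have "weight (- s) \<alpha> = - weight s \<alpha>" for \<alpha> by (simp add: weight_def sum_negf)
  then show ?thesis
    by (simp add: act_def matrix_inv_lens_generator power_prod_sum_def fun_eq_iff power_prod_lens_generator mult.assoc)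
qed

text \<open>Group elements are diagonal on the independent monomials, so invariance is a condition
  on each coefficient: a nonzero one needs eigenvalue 1, and the generator alone already forces
  this.\<close>

lemma act_invariant_iff:
  assumes "q > 0"
  shows "(\<forall>A\<in>lens_group q s. act A (power_prod_sum complex_coord c k) = power_prod_sum complex_coord c k) \<longleftrightarrow>
     (\<forall>\<alpha>\<in>exponents k. c \<alpha> \<noteq> 0 \<longrightarrow> int q dvd weight s \<alpha>)" (is "?L \<longleftrightarrow> ?R")
proof
  assume ?L
  have "lens_generator q s \<in> lens_group q s"
    unfolding lens_group_eq by (rule range_eqI[of _ _ 1]) (simp add: vec_eq_iff[of _ s])
  with \<open>?L\<close> have "act (lens_generator q s) (power_prod_sum complex_coord c k) = power_prod_sum complex_coord c k"
    by blast
  then have "\<forall>\<alpha>\<in>exponents k. c \<alpha> * cis (2 * pi * of_int (weight s \<alpha>) / of_nat q) = c \<alpha>"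
    unfolding act_lens_generator power_prod_sum_eq_iff .
  then show ?R using cis_eq_1_iff_dvd[OF assms] by auto
next
  assume ?R
  show ?L
    unfolding lens_group_eq
  proof clarify
    fix m :: int
    have "c \<alpha> * cis (2 * pi * of_int (m * weight s \<alpha>) / of_nat q) = c \<alpha>" if "\<alpha> \<in> exponents k" for \<alpha>
      using cis_eq_1_iff_dvd[OF assms, of "m * weight s \<alpha>"] \<open>?R\<close> that by (cases "c \<alpha> = 0") auto
    then show "act (lens_generator q (\<chi> j. m * s $ j)) (power_prod_sum complex_coord c k) = power_prod_sum complex_coord c k"
      by (simp add: act_lens_generator power_prod_sum_eq_iff weight_scale)
  qed
qed

section \<open>Harmonic forms from their coefficients at reduced exponents\<close>

definition lower_pair :: "'n \<Rightarrow> ('n \<times> 2 \<Rightarrow> nat) \<Rightarrow> 'n \<times> 2 \<Rightarrow> nat" where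
  "lower_pair j \<alpha> = \<alpha>((j, 1) := \<alpha> (j, 1) - 1, (j, 2) := \<alpha> (j, 2) - 1)"

lemma raise_lower_pair: "\<alpha> (p, 1) > 0 \<Longrightarrow> \<alpha> (p, 2) > 0 \<Longrightarrow> raise_pair p (lower_pair p \<alpha>) = \<alpha>"
  by (auto simp: raise_pair_def lower_pair_def fun_eq_iff)

lemma lower_raise_pair: "lower_pair p (raise_pair p \<beta>) = \<beta>"
  by (auto simp: raise_pair_def lower_pair_def fun_eq_iff)

lemma raise_pair_nth: "raise_pair j \<beta> (l, a) = \<beta> (l, a) + (if l = j then 1 else 0)"
  using exhaust_2[of a] by (auto simp: raise_pair_def)

lemma weight_raise_pair [simp]: "weight s (raise_pair j \<beta>) = weight s \<beta>"
  by (auto simp: weight_def raise_pair_nth intro!: sum.cong)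

lemma sum_raise_pair: "(\<Sum>i\<in>UNIV. raise_pair (j::'n::finite) \<beta> i) = (\<Sum>i\<in>UNIV. \<beta> i) + 2"
  by (simp add: sum_UNIV_times_2 raise_pair_nth sum.distrib)

lemma raise_pair_in_exponents: "raise_pair j \<beta> \<in> exponents (Suc (Suc k)) \<longleftrightarrow> \<beta> \<in> exponents k"
  by (simp add: exponents_def sum_raise_pair)

text \<open>Solves the recursion expressing that the Laplacian vanishes, by induction on the exponent of
  \<open>z\<^sub>p * cnj z\<^sub>p\<close>; the value is meaningful only for \<open>r = min (\<alpha> (p, 1)) (\<alpha> (p, 2))\<close>.\<close>

primrec harmonic_extension_aux ::
  "'n::finite \<Rightarrow> (('n \<times> 2 \<Rightarrow> nat) \<Rightarrow> complex) \<Rightarrow> nat \<Rightarrow> ('n \<times> 2 \<Rightarrow> nat) \<Rightarrow> complex" where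
  "harmonic_extension_aux p f 0 \<alpha> = f \<alpha>"
| "harmonic_extension_aux p f (Suc r) \<alpha> =
     - (\<Sum>j\<in>UNIV - {p}. of_nat ((lower_pair p \<alpha> (j, 1) + 1) * (lower_pair p \<alpha> (j, 2) + 1)) *
          harmonic_extension_aux p f r (raise_pair j (lower_pair p \<alpha>))) / of_nat (\<alpha> (p, 1) * \<alpha> (p, 2))"

definition harmonic_extension ::
  "'n::finite \<Rightarrow> (('n \<times> 2 \<Rightarrow> nat) \<Rightarrow> complex) \<Rightarrow> ('n \<times> 2 \<Rightarrow> nat) \<Rightarrow> complex" where
  "harmonic_extension p f \<alpha> = harmonic_extension_aux p f (min (\<alpha> (p, 1)) (\<alpha> (p, 2))) \<alpha>"

lemma harmonic_extension_base:
  "\<alpha> (p, 1) = 0 \<or> \<alpha> (p, 2) = 0 \<Longrightarrow> harmonic_extension p f \<alpha> = f \<alpha>"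
  by (auto simp: harmonic_extension_def)

text \<open>Only the \<open>p\<close>-term of the Laplacian raises the minimum at block
  \<open>p\<close>; the other terms keep that of \<open>\<beta>\<close>. The recursion step is the
  Laplace equation solved for the \<open>p\<close>-term.\<close>

lemma coeff_laplacian_harmonic_extension: "coeff_laplacian (harmonic_extension p f) \<beta> = 0"
proof -
  define r where "r = min (\<beta> (p, 1)) (\<beta> (p, 2))"
  define S where "S = (\<Sum>j\<in>UNIV - {p}. of_nat ((\<beta> (j, 1) + 1) * (\<beta> (j, 2) + 1)) *
          harmonic_extension_aux p f r (raise_pair j \<beta>))"
  have p: "harmonic_extension p f (raise_pair p \<beta>) =
      - S / of_nat ((\<beta> (p, 1) + 1) * (\<beta> (p, 2) + 1))"
    by (simp add: harmonic_extension_def raise_pair_nth r_def S_def lower_raise_pair)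
  have "harmonic_extension p f (raise_pair j \<beta>) = harmonic_extension_aux p f r (raise_pair j \<beta>)" if "j \<noteq> p" for j
    using that by (simp add: harmonic_extension_def raise_pair_nth r_def)
  then have "S = (\<Sum>j\<in>UNIV - {p}. of_nat ((\<beta> (j, 1) + 1) * (\<beta> (j, 2) + 1)) *
          harmonic_extension p f (raise_pair j \<beta>))"
    unfolding S_def by (intro sum.cong) auto
  then have "coeff_laplacian (harmonic_extension p f) \<beta> =
    of_nat ((\<beta> (p, 1) + 1) * (\<beta> (p, 2) + 1)) * harmonic_extension p f (raise_pair p \<beta>) + S"
    unfolding coeff_laplacian_def by (subst sum.remove[of _ p]) auto
  then show ?thesis unfolding p by (simp del: of_nat_mult of_nat_add of_nat_Suc)
qed

text \<open>Raising and lowering pairs preserves the weight, so the recursion expresses a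
  coefficient through coefficients of the same weight.\<close>

lemma harmonic_extension_support:
  assumes "\<And>\<alpha>. f \<alpha> \<noteq> 0 \<Longrightarrow> int q dvd weight s \<alpha>" and "harmonic_extension p f \<alpha> \<noteq> 0"
  shows "int q dvd weight s \<alpha>"
proof -
  have "harmonic_extension_aux p f r \<alpha> = 0"
    if "\<not> int q dvd weight s \<alpha>" "r \<le> \<alpha> (p, 1)" "r \<le> \<alpha> (p, 2)" for r \<alpha>
    using that
  proof (induction r arbitrary: \<alpha>)
    case 0
    then show ?case using assms(1) by auto
  next
    case (Suc r)
    have "raise_pair p (lower_pair p \<alpha>) = \<alpha>" using Suc.prems by (intro raise_lower_pair) auto
    then have "weight s (lower_pair p \<alpha>) = weight s \<alpha>" by (metis weight_raise_pair)
    then have "harmonic_extension_aux p f r (raise_pair j (lower_pair p \<alpha>)) = 0" for j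
      using Suc.prems by (intro Suc.IH) (auto simp: raise_pair_nth, auto simp: lower_pair_def)
    then show ?case by simp
  qed
  then show ?thesis using assms(2) unfolding harmonic_extension_def by (meson min.cobounded1 min.cobounded2)
qed

text \<open>One Laplace equation expresses a coefficient through those with a smaller minimum at
  block \<open>p\<close>, down to minimum 0, where \<open>base\<close> applies.\<close>

lemma coeff_laplacian_unique:
  assumes lap: "\<And>\<beta>. \<beta> \<in> exponents k \<Longrightarrow> coeff_laplacian d \<beta> = 0"
    and base: "\<And>\<alpha>. \<alpha> \<in> exponents (Suc (Suc k)) \<Longrightarrow> \<alpha> (p, 1) = 0 \<or> \<alpha> (p, 2) = 0 \<Longrightarrow> d \<alpha> = 0"
    and "\<alpha> \<in> exponents (Suc (Suc k))"
  shows "d \<alpha> = 0"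
  using assms(3)
proof (induction "min (\<alpha> (p, 1)) (\<alpha> (p, 2))" arbitrary: \<alpha>)
  case 0
  then show ?case by (intro base) (auto simp: min_def split: if_splits)
next
  case (Suc r)
  define \<beta> where "\<beta> = lower_pair p \<alpha>"
  have \<alpha>: "\<alpha> = raise_pair p \<beta>" unfolding \<beta>_def using Suc.hyps(2) by (intro raise_lower_pair[symmetric]) auto
  have \<beta>: "\<beta> \<in> exponents k" using Suc.prems unfolding \<alpha> raise_pair_in_exponents .
  have "d (raise_pair j \<beta>) = 0" if "j \<noteq> p" for j
    using Suc.hyps(2) that \<beta> by (intro Suc.hyps(1)) (auto simp: \<alpha> raise_pair_nth raise_pair_in_exponents)
  then have "coeff_laplacian d \<beta> = of_nat ((\<beta> (p, 1) + 1) * (\<beta> (p, 2) + 1)) * d \<alpha>"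
    unfolding coeff_laplacian_def \<alpha> by (subst sum.remove[of _ p]) auto
  with lap[OF \<beta>] show ?case by (simp del: of_nat_mult of_nat_add of_nat_Suc)
qed

lemma finite_reduced_exponents: "finite (reduced_exponents q s p k)"
  by (rule finite_subset[OF _ finite_exponents[of k]]) (auto simp: reduced_exponents_def weighted_exponents_def)

lemma power_prod_sum_in_invariant_iff:
  fixes s :: "int^'n"
  assumes "q > 0"
  shows "power_prod_sum complex_coord c k \<in> invariant_harmonic_polys (lens_group q s) k \<longleftrightarrow>
    (\<forall>\<beta>. (\<Sum>i\<in>UNIV. \<beta> i) + 2 = k \<longrightarrow> coeff_laplacian c \<beta> = 0) \<and>
    (\<forall>\<alpha>\<in>exponents k. c \<alpha> \<noteq> 0 \<longrightarrow> int q dvd weight s \<alpha>)"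
  unfolding invariant_harmonic_polys_def mem_Collect_eq act_invariant_iff[OF assms]
    power_prod_sum_in_harmonic_polys_iff ..

text \<open>The basis consists of the harmonic extensions of the delta functions at reduced
  exponents. Independence is read off at those exponents; spanning is uniqueness of the
  extension.\<close>

lemma dim_invariant_harmonic_polys:
  fixes s :: "int^'n"
  assumes "q > 0"
  shows "fn.dim (invariant_harmonic_polys (lens_group q s) k) = card (reduced_exponents q s p k)"
proof -
  let ?J = "reduced_exponents q s p k"
  define e where "e \<alpha> = harmonic_extension p (\<lambda>\<beta>. if \<beta> = \<alpha> then 1 else 0)" for \<alpha>
  define h where "h \<alpha> = power_prod_sum complex_coord (e \<alpha>) k" for \<alpha>
  have e_base: "e \<alpha> \<beta> = (if \<beta> = \<alpha> then 1 else 0)" if "\<beta> (p, 1) = 0 \<or> \<beta> (p, 2) = 0" for \<alpha> \<beta>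
    unfolding e_def using that by (simp add: harmonic_extension_base)
  have sum_h: "(\<Sum>\<alpha>\<in>?J. fun_scale (g \<alpha>) (h \<alpha>)) = power_prod_sum complex_coord (\<lambda>\<beta>. \<Sum>\<alpha>\<in>?J. g \<alpha> * e \<alpha> \<beta>) k" for g
    unfolding sum_fun_scale h_def power_prod_sum_def sum_distrib_left sum_distrib_right
    by (rule ext, subst sum.swap) (simp add: mult.assoc)
  have J_sub: "\<alpha> \<in> exponents k" "\<alpha> (p, 1) = 0 \<or> \<alpha> (p, 2) = 0" "int q dvd weight s \<alpha>" if "\<alpha> \<in> ?J" for \<alpha>
    using that by (auto simp: reduced_exponents_def weighted_exponents_def)
  have coeff_J: "(\<Sum>\<alpha>\<in>?J. g \<alpha> * e \<alpha> \<beta>) = g \<beta>" if "\<beta> \<in> ?J" for g \<beta>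
  proof -
    have "(\<Sum>\<alpha>\<in>?J. g \<alpha> * e \<alpha> \<beta>) = (\<Sum>\<alpha>\<in>?J. if \<beta> = \<alpha> then g \<alpha> else 0)"
      using J_sub[OF that] by (intro sum.cong) (auto simp: e_base)
    then show ?thesis using that by (simp add: finite_reduced_exponents)
  qed
  have inj: "inj_on h ?J"
  proof (rule inj_onI)
    fix \<alpha> \<beta> assume *: "\<alpha> \<in> ?J" "\<beta> \<in> ?J" "h \<alpha> = h \<beta>"
    then have "e \<alpha> \<alpha> = e \<beta> \<alpha>" using J_sub by (auto simp: h_def power_prod_sum_eq_iff)
    then show "\<alpha> = \<beta>" using J_sub(2)[OF *(1)] by (auto simp: e_base split: if_splits)
  qed
  have indep: "fn.independent (h ` ?J)"
  proof (rule fn.independent_if_scalars_zero)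
    show "finite (h ` ?J)" by (simp add: finite_reduced_exponents)
    fix g x assume 0: "(\<Sum>x\<in>h ` ?J. fun_scale (g x) x) = 0" and "x \<in> h ` ?J"
    then obtain \<beta> where \<beta>: "\<beta> \<in> ?J" "x = h \<beta>" by auto
    from 0 have "power_prod_sum complex_coord (\<lambda>\<beta>. \<Sum>\<alpha>\<in>?J. g (h \<alpha>) * e \<alpha> \<beta>) k = (\<lambda>_. 0)"
      by (simp add: sum.reindex[OF inj] sum_h zero_fun_def)
    with J_sub(1)[OF \<beta>(1)] have "(\<Sum>\<alpha>\<in>?J. g (h \<alpha>) * e \<alpha> \<beta>) = 0"
      by (simp add: power_prod_sum_eq_zero_iff)
    then show "g x = 0" using coeff_J[OF \<beta>(1)] \<beta>(2) by simp
  qed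
  have sub: "h ` ?J \<subseteq> invariant_harmonic_polys (lens_group q s) k"
  proof clarify
    fix \<alpha> assume \<alpha>: "\<alpha> \<in> ?J"
    have "int q dvd weight s \<beta>" if "e \<alpha> \<beta> \<noteq> 0" for \<beta>
      using that J_sub(3)[OF \<alpha>] unfolding e_def
      by (elim harmonic_extension_support[rotated]) (auto split: if_splits)
    then show "h \<alpha> \<in> invariant_harmonic_polys (lens_group q s) k"
      unfolding h_def power_prod_sum_in_invariant_iff[OF assms]
      by (auto simp: e_def coeff_laplacian_harmonic_extension)
  qed
  have span: "invariant_harmonic_polys (lens_group q s) k \<subseteq> fn.span (h ` ?J)"
  proof
    fix P assume P: "P \<in> invariant_harmonic_polys (lens_group q s) k"
    then have "P \<in> homogeneous_polys k"
      by (auto simp: invariant_harmonic_polys_def harmonic_polys_def)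
    then obtain c where c: "P = power_prod_sum complex_coord c k"
      unfolding homogeneous_polys_eq_forms forms_def by auto
    have lap: "coeff_laplacian c \<beta> = 0" if "(\<Sum>i\<in>UNIV. \<beta> i) + 2 = k" for \<beta>
      using P that unfolding c power_prod_sum_in_invariant_iff[OF assms] by blast
    have wt: "int q dvd weight s \<alpha>" if "\<alpha> \<in> exponents k" "c \<alpha> \<noteq> 0" for \<alpha>
      using P that unfolding c power_prod_sum_in_invariant_iff[OF assms] by blast
    \<comment> \<open>The error left after subtracting the combination prescribed by the reduced
      coefficients. It is harmonic and vanishes wherever one exponent at block \<open>p\<close> is
      0, so uniqueness makes it zero.\<close>
    define d where "d = (\<lambda>\<beta>. c \<beta> - (\<Sum>\<alpha>\<in>?J. c \<alpha> * e \<alpha> \<beta>))"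
    have d_base: "d \<alpha> = 0" if "\<alpha> \<in> exponents k" "\<alpha> (p, 1) = 0 \<or> \<alpha> (p, 2) = 0" for \<alpha>
    proof (cases "\<alpha> \<in> ?J")
      case True
      then show ?thesis by (simp add: d_def coeff_J)
    next
      case False
      then have "c \<alpha> = 0" using wt[OF that(1)] that
        by (auto simp: reduced_exponents_def weighted_exponents_def)
      moreover have "e \<beta> \<alpha> = 0" if "\<beta> \<in> ?J" for \<beta>
        using that False e_base[OF \<open>\<alpha> (p, 1) = 0 \<or> \<alpha> (p, 2) = 0\<close>] by auto
      ultimately show ?thesis by (simp add: d_def)
    qed
    have d_lap: "coeff_laplacian d \<beta> = 0" if "(\<Sum>i\<in>UNIV. \<beta> i) + 2 = k" for \<beta>
    proof -
      have "(\<Sum>\<alpha>\<in>?J. c \<alpha> * coeff_laplacian (e \<alpha>) \<beta>) =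
          (\<Sum>j\<in>UNIV. of_nat ((\<beta> (j, 1) + 1) * (\<beta> (j, 2) + 1)) * (\<Sum>\<alpha>\<in>?J. c \<alpha> * e \<alpha> (raise_pair j \<beta>)))"
        unfolding coeff_laplacian_def sum_distrib_left
        by (subst sum.swap) (intro sum.cong refl mult.left_commute)
      moreover have "coeff_laplacian d \<beta> = coeff_laplacian c \<beta> -
          (\<Sum>j\<in>UNIV. of_nat ((\<beta> (j, 1) + 1) * (\<beta> (j, 2) + 1)) * (\<Sum>\<alpha>\<in>?J. c \<alpha> * e \<alpha> (raise_pair j \<beta>)))"
        unfolding coeff_laplacian_def d_def right_diff_distrib sum_subtractf ..
      ultimately have "coeff_laplacian d \<beta> = coeff_laplacian c \<beta> - (\<Sum>\<alpha>\<in>?J. c \<alpha> * coeff_laplacian (e \<alpha>) \<beta>)"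
        by (simp only:)
      then show ?thesis using lap[OF that] by (simp add: e_def coeff_laplacian_harmonic_extension)
    qed
    have "d \<alpha> = 0" if \<alpha>: "\<alpha> \<in> exponents k" for \<alpha>
    proof (cases "\<alpha> (p, 1) = 0 \<or> \<alpha> (p, 2) = 0")
      case False
      then have "\<alpha> = raise_pair p (lower_pair p \<alpha>)" by (intro raise_lower_pair[symmetric]) auto
      with \<alpha> have "(\<Sum>i\<in>UNIV. lower_pair p \<alpha> i) + 2 = k"
        by (metis (mono_tags, lifting) exponents_def mem_Collect_eq sum_raise_pair)
      then obtain m where k: "k = Suc (Suc m)" by (metis add_2_eq_Suc')
      show ?thesis
      proof (rule coeff_laplacian_unique[of m d p])
        show "coeff_laplacian d \<beta> = 0" if "\<beta> \<in> exponents m" for \<beta>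
          by (rule d_lap) (use that k in \<open>simp add: exponents_def\<close>)
        show "d \<gamma> = 0" if "\<gamma> \<in> exponents (Suc (Suc m))" "\<gamma> (p, 1) = 0 \<or> \<gamma> (p, 2) = 0" for \<gamma>
          using d_base[OF _ that(2)] that(1) unfolding k .
        show "\<alpha> \<in> exponents (Suc (Suc m))" using \<alpha> unfolding k .
      qed
    qed (use d_base \<alpha> in auto)
    then have "P = (\<Sum>\<alpha>\<in>?J. fun_scale (c \<alpha>) (h \<alpha>))"
      unfolding c sum_h power_prod_sum_eq_iff d_def right_minus_eq by blast
    then show "P \<in> fn.span (h ` ?J)"
      by (simp only:) (intro fn.span_sum fn.span_scale fn.span_base imageI)
  qed
  show ?thesis
    by (rule fn.dim_unique[OF sub span indep]) (simp add: card_image[OF inj])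
qed

section \<open>The generating function\<close>

lemma sphere_eigenvalue_eq:
  "sphere_eigenvalue TYPE('n::finite \<times> 2) k = real k * (real k + 2 * real CARD('n) - 2)"
  by (simp add: sphere_eigenvalue_def)

text \<open>k (k + 2n - 2) is strictly increasing in k, also for n = 1, where it is k^2. Hence each
  multiplicity in the spectrum is the dimension for a single degree.\<close>

lemma inj_sphere_eigenvalue: "inj (sphere_eigenvalue TYPE('n::finite \<times> 2))"
proof (rule injI, rule ccontr)
  fix j k :: nat
  assume eq: "sphere_eigenvalue TYPE('n \<times> 2) j = sphere_eigenvalue TYPE('n \<times> 2) k" and "j \<noteq> k"
  have n: "real CARD('n) \<ge> 1" by (simp add: Suc_le_eq)
  have "sphere_eigenvalue TYPE('n \<times> 2) a < sphere_eigenvalue TYPE('n \<times> 2) b" if "a < b" for a b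
    unfolding sphere_eigenvalue_eq
    using that n by (intro mult_strict_mono') linarith+
  then show False using eq \<open>j \<noteq> k\<close> by (metis less_irrefl nat_neq_iff)
qed

lemma spectrum_lens_group:
  fixes s :: "int^'n"
  assumes "q > 0"
  shows "spectrum (lens_group q s) (sphere_eigenvalue TYPE('n \<times> 2) k) = card (reduced_exponents q s p k)"
proof -
  have "{k'. sphere_eigenvalue TYPE('n \<times> 2) k' = sphere_eigenvalue TYPE('n \<times> 2) k} = {k}"
    using injD[OF inj_sphere_eigenvalue] by auto
  then show ?thesis by (simp add: spectrum_def dim_invariant_harmonic_polys[OF assms])
qed

lemma card_reduced_exponents_pos:
  fixes s :: "int^'n"
  shows "card (reduced_exponents q s p (q * i)) > 0"
proof -
  \<comment> \<open>The monomial z_p^(q i), invariant whatever the parameters are; it shows that all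
    multiples of \<open>q\<close> occur as degrees in the spectrum.\<close>
  let ?\<alpha> = "(\<lambda>_. 0)((p, 1::2) := q * i)"
  have "weight s ?\<alpha> = s $ p * (int q * int i)"
    unfolding weight_def by (subst sum.remove[of _ p]) auto
  then have "?\<alpha> \<in> reduced_exponents q s p (q * i)"
    using sum_fun_upd_UNIV[of "\<lambda>_. 0" "(p, 1::2)" "q * i"]
    by (simp add: reduced_exponents_def weighted_exponents_def exponents_def)
  then show ?thesis using finite_reduced_exponents card_gt_0_iff by blast
qed

text \<open>Completing the square: two squares at a fixed nonzero distance are bounded.\<close>

lemma nat_eq_of_shared_squares:
  fixes a b q :: nat
  assumes "q > 0" and "\<And>i. \<exists>k. int (q * i) * (int (q * i) + 2 * int a) = int k * (int k + 2 * int b)"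
  shows "a = b"
proof (rule ccontr)
  assume "a \<noteq> b"
  define D where "D = int a ^ 2 - int b ^ 2"
  \<comment> \<open>Large enough for x to exceed the absolute value of D, whereas (x - y)(x + y) = D
    with x different from y bounds x by it.\<close>
  define i where "i = nat \<bar>D\<bar> + 1"
  obtain k where k: "int (q * i) * (int (q * i) + 2 * int a) = int k * (int k + 2 * int b)"
    using assms(2) by blast
  define x y where "x = int (q * i) + int a" and "y = int k + int b"
  have D: "(x - y) * (x + y) = D"
    using k by (simp add: x_def y_def D_def power2_eq_square algebra_simps)
  have "D \<noteq> 0" using \<open>a \<noteq> b\<close> by (auto simp: D_def)
  then have "x \<noteq> y" using D by auto
  have "i \<le> q * i" using assms(1) by simp
  then have "int i \<le> int (q * i)" by (simp only: of_nat_le_iff)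
  moreover have "int i = \<bar>D\<bar> + 1" by (simp add: i_def)
  ultimately have "\<bar>D\<bar> < x" unfolding x_def by linarith
  also have "x \<le> \<bar>x - y\<bar> * (x + y)"
  proof -
    have "0 \<le> x + y" "x \<le> 1 * (x + y)" "1 \<le> \<bar>x - y\<bar>" using \<open>x \<noteq> y\<close> by (auto simp: x_def y_def)
    then show ?thesis using mult_right_mono order_trans by blast
  qed
  also have "\<dots> = \<bar>D\<bar>" unfolding D[symmetric] abs_mult by (simp add: x_def y_def)
  finally show False by simp
qed

text \<open>The eigenvalue of degree k is (k + n - 1)^2 - (n - 1)^2 for n blocks. If the numbers of
  blocks differed, infinitely many pairs of squares would have the same nonzero difference.\<close>

lemma isospectral_imp_CARD_eq:
  fixes s :: "int^'n" and t :: "int^'m"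
  assumes "q > 0" and "isospectral (lens_group q s) (lens_group q t)"
  shows "CARD('n) = CARD('m)"
proof -
  have pos: "CARD('n) > 0" "CARD('m) > 0" by simp_all
  have "\<exists>k. int (q * i) * (int (q * i) + 2 * int (CARD('n) - 1)) = int k * (int k + 2 * int (CARD('m) - 1))" for i
  proof -
    let ?\<mu> = "sphere_eigenvalue TYPE('n \<times> 2) (q * i)"
    have "spectrum (lens_group q t) ?\<mu> > 0"
      using assms(2) card_reduced_exponents_pos[of q s _ i]
      by (simp add: isospectral_def fun_eq_iff flip: spectrum_lens_group[OF assms(1)])
    then obtain k where "sphere_eigenvalue TYPE('m \<times> 2) k = ?\<mu>"
      unfolding spectrum_def by (metis (mono_tags, lifting) empty_Collect_eq less_irrefl sum.empty)
    then have "real (q * i) * (real (q * i) + 2 * real CARD('n) - 2) = real k * (real k + 2 * real CARD('m) - 2)"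
      unfolding sphere_eigenvalue_eq by simp
    then have "real_of_int (int (q * i) * (int (q * i) + 2 * int (CARD('n) - 1))) =
        real_of_int (int k * (int k + 2 * int (CARD('m) - 1)))"
      using pos by (simp add: of_nat_diff algebra_simps)
    then show ?thesis by (simp only: of_int_eq_iff) blast
  qed
  from nat_eq_of_shared_squares[OF assms(1) this] show ?thesis using pos by linarith
qed

section \<open>From harmonic dimensions to the number of all invariant monomials\<close>

lemma finite_weighted_exponents: "finite (weighted_exponents q s k)"
  by (rule finite_subset[OF _ finite_exponents[of k]]) (auto simp: weighted_exponents_def)

text \<open>The counterpart of splitting polynomials into harmonic ones and multiples of the squared
  norm: here by divisibility by z_p * cnj z_p.\<close>

lemma card_weighted_exponents:
  "card (weighted_exponents q s (Suc (Suc k))) =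
     card (reduced_exponents q s p (Suc (Suc k))) + card (weighted_exponents q s k)"
proof -
  let ?R = "reduced_exponents q s p (Suc (Suc k))"
  have "weighted_exponents q s (Suc (Suc k)) = ?R \<union> raise_pair p ` weighted_exponents q s k"
  proof (intro equalityI subsetI)
    fix \<alpha> assume \<alpha>: "\<alpha> \<in> weighted_exponents q s (Suc (Suc k))"
    show "\<alpha> \<in> ?R \<union> raise_pair p ` weighted_exponents q s k"
    proof (cases "\<alpha> (p, 1) = 0 \<or> \<alpha> (p, 2) = 0")
      case False
      then have eq: "raise_pair p (lower_pair p \<alpha>) = \<alpha>" by (intro raise_lower_pair) auto
      then have "lower_pair p \<alpha> \<in> weighted_exponents q s k"
        using \<alpha> raise_pair_in_exponents[of p "lower_pair p \<alpha>" k] weight_raise_pair[of s p "lower_pair p \<alpha>"]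
        by (simp add: weighted_exponents_def)
      then show ?thesis using eq by (metis UnI2 imageI)
    qed (use \<alpha> in \<open>auto simp: reduced_exponents_def\<close>)
  qed (auto simp: reduced_exponents_def weighted_exponents_def raise_pair_in_exponents)
  moreover have "?R \<inter> raise_pair p ` weighted_exponents q s k = {}"
    by (auto simp: reduced_exponents_def raise_pair_nth)
  moreover have "inj (raise_pair p)" by (metis injI lower_raise_pair)
  ultimately show ?thesis
    by (simp add: card_Un_disjoint finite_reduced_exponents finite_weighted_exponents card_image inj_on_subset)
qed

lemma weighted_eq_reduced_exponents:
  fixes s :: "int^'n"
  assumes "k < 2"
  shows "weighted_exponents q s k = reduced_exponents q s p k"
proof -
  have "\<alpha> (p, 1) = 0 \<or> \<alpha> (p, 2) = 0" if "\<alpha> \<in> exponents k" for \<alpha> :: "'n \<times> 2 \<Rightarrow> nat"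
  proof -
    have "\<alpha> (p, 1) + \<alpha> (p, 2) = (\<Sum>i\<in>{(p, 1), (p, 2)}. \<alpha> i)" by simp
    also have "\<dots> \<le> (\<Sum>i\<in>UNIV. \<alpha> i)" by (rule sum_mono2) auto
    also have "\<dots> = k" using that by (simp add: exponents_def)
    finally show ?thesis using \<open>k < 2\<close> by linarith
  qed
  then have "\<alpha> (p, 1) = 0 \<or> \<alpha> (p, 2) = 0" if "\<alpha> \<in> weighted_exponents q s k" for \<alpha>
    using that unfolding weighted_exponents_def mem_Collect_eq by (elim conjE)
  then have "reduced_exponents q s p k = {\<alpha> \<in> weighted_exponents q s k. True}"
    unfolding reduced_exponents_def by (intro Collect_cong conj_cong refl) (simp only:)
  then show ?thesis by simp
qed

lemma isospectral_imp_card_weighted_exponents_eq: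
  fixes s :: "int^'n" and t :: "int^'m"
  assumes "q > 0" and "isospectral (lens_group q s) (lens_group q t)"
  shows "card (weighted_exponents q s k) = card (weighted_exponents q t k)"
proof -
  have reduced: "card (reduced_exponents q s p k) = card (reduced_exponents q t p' k)" for p p' k
  proof -
    have "sphere_eigenvalue TYPE('n \<times> 2) k = sphere_eigenvalue TYPE('m \<times> 2) k"
      by (simp add: sphere_eigenvalue_eq isospectral_imp_CARD_eq[OF assms])
    then show ?thesis
      using assms(2) unfolding isospectral_def by (metis spectrum_lens_group[OF assms(1)])
  qed
  show ?thesis
  proof (induction k rule: induct_nat_012)
    case (ge2 k)
    then show ?case using reduced by (simp add: card_weighted_exponents[of q _ k undefined])
  qed (use reduced in \<open>simp_all add: weighted_eq_reduced_exponents[of _ q _ undefined]\<close>)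
qed

text \<open>The determinant of 1 - z R for the rotation R of one block, so that the product over the
  blocks is the denominator in Molien's formula.\<close>

definition lens_factor :: "nat \<Rightarrow> int \<Rightarrow> complex \<Rightarrow> complex" where
  "lens_factor q c z =
     (1 - cis (2 * pi * of_int c / of_nat q) * z) * (1 - cis (- (2 * pi * of_int c / of_nat q)) * z)"

lemma has_sum_prod_geometric:
  fixes x :: "'d::finite \<Rightarrow> complex"
  assumes "\<And>i. norm (x i) < 1"
  shows "((\<lambda>\<alpha>. \<Prod>i\<in>UNIV. x i ^ \<alpha> i) has_sum (\<Prod>i\<in>UNIV. 1 / (1 - x i))) UNIV"
proof -
  have abs: "(\<lambda>n. norm (x i ^ n)) summable_on UNIV" for i
    using norm_summable_imp_summable_on[of "\<lambda>n. norm (x i ^ n)"] assms[of i]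
    by (simp add: norm_power summable_geometric)
  have "((\<lambda>n. x i ^ n) has_sum (1 / (1 - x i))) UNIV" for i
    by (rule norm_summable_imp_has_sum)
       (use assms[of i] in \<open>auto simp: norm_power summable_geometric geometric_sums\<close>)
  then have "infsum (\<lambda>n. x i ^ n) UNIV = 1 / (1 - x i)" for i by (rule infsumI)
  then have inf: "infsum (\<lambda>\<alpha>. \<Prod>i\<in>UNIV. x i ^ \<alpha> i) UNIV = (\<Prod>i\<in>UNIV. 1 / (1 - x i))"
    using infsum_prod_PiE_abs[of UNIV "\<lambda>i n. x i ^ n" "\<lambda>_. UNIV"] abs by simp
  have "x i \<noteq> 1" for i using assms[of i] by auto
  then have "(\<Prod>i\<in>UNIV. 1 / (1 - x i)) \<noteq> 0" by (auto simp: eq_commute[of 1])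
  \<comment> \<open>\<open>infsum\<close> is 0 on families that are not summable, so a nonzero value
    proves summability.\<close>
  with inf have "(\<lambda>\<alpha>. \<Prod>i\<in>UNIV. x i ^ \<alpha> i) summable_on UNIV" using infsum_not_exists by fastforce
  then show ?thesis unfolding inf[symmetric] by (rule has_sum_infsum)
qed

lemma has_sum_sum_finite:
  fixes f :: "'i \<Rightarrow> 'a \<Rightarrow> 'b::topological_comm_monoid_add"
  assumes "\<And>i. (f i has_sum S i) A"
  shows "((\<lambda>x. \<Sum>i\<in>I. f i x) has_sum (\<Sum>i\<in>I. S i)) A"
  by (induction I rule: infinite_finite_induct) (simp_all add: has_sum_add assms)

text \<open>Orthogonality of characters of Z/q: the geometric sum of a nontrivial q-th root of unity
  vanishes.\<close>

lemma sum_cis_powers: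
  assumes "q > 0"
  shows "(\<Sum>l<q. cis (- 2 * pi * of_int (int l * w) / of_nat q)) = (if int q dvd w then of_nat q else 0)"
proof -
  let ?r = "cis (2 * pi * of_int (- w) / of_nat q)"
  have r: "cis (- 2 * pi * of_int (int l * w) / of_nat q) = ?r ^ l" for l
    by (simp only: Complex.DeMoivre) (rule arg_cong[of _ _ cis], simp)
  show ?thesis
  proof (cases "int q dvd w")
    case True
    then have "?r = 1" using cis_eq_1_iff_dvd[OF assms, of "- w"] by simp
    then show ?thesis unfolding r using True by simp
  next
    case False
    then have "?r \<noteq> 1" using cis_eq_1_iff_dvd[OF assms, of "- w"] by simp
    moreover have "?r ^ q = 1"
      using cis_eq_1_iff_dvd[OF assms, of "int q * - w"] unfolding r[symmetric] by simp
    ultimately show ?thesis unfolding r using False by (simp add: geometric_sum)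
  qed
qed

text \<open>Molien's formula: summing the diagonal action over l keeps exactly the invariant
  monomials, each with factor \<open>q\<close>.\<close>

lemma has_sum_weighted_exponents:
  fixes s :: "int^'n"
  assumes "q > 0" and "norm z < 1"
  shows "((\<lambda>k. of_nat (q * card (weighted_exponents q s k)) * z ^ k) has_sum
     (\<Sum>l<q. \<Prod>j\<in>UNIV. 1 / lens_factor q (int l * s $ j) z)) UNIV"
proof -
  \<comment> \<open>All complex coordinates of this point are 1, so transformed coordinates and
    monomials evaluated here are the eigenvalues.\<close>
  define x0 :: "real^('n \<times> 2)" where "x0 = (\<chi> i. if snd i = 1 then 1 else 0)"
  have x0: "complex_coord i x0 = 1" for i
    by (cases i) (auto simp: x0_def complex_coord_def complex_eq_iff)
  define \<xi> where "\<xi> l i = complex_coord i (lens_generator q (\<chi> j. int l * s $ j) *v x0)" for l i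
  have \<xi>: "\<xi> l (j, a) = cis ((if a = 1 then -1 else 1) * (2 * pi * of_int (int l * s $ j) / of_nat q))" for l j a
    by (simp add: \<xi>_def complex_coord_lens_generator x0)
  have norm_\<xi>: "norm (\<xi> l i) = 1" for l i by (cases i) (simp only: \<xi> norm_cis)
  have prod_\<xi>: "(\<Prod>i\<in>UNIV. \<xi> l i ^ \<alpha> i) = cis (- 2 * pi * of_int (int l * weight s \<alpha>) / of_nat q)" for l \<alpha>
    using power_prod_lens_generator[of \<alpha> q "\<chi> j. int l * s $ j" x0]
    unfolding weight_scale by (simp add: power_prod_def \<xi>_def x0)
  have "((\<lambda>\<alpha>. \<Prod>i\<in>UNIV. (\<xi> l i * z) ^ \<alpha> i) has_sum (\<Prod>j\<in>UNIV. 1 / lens_factor q (int l * s $ j) z)) UNIV" for l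
  proof -
    have "(\<Prod>i\<in>UNIV. 1 / (1 - \<xi> l i * z)) = (\<Prod>j\<in>UNIV. 1 / lens_factor q (int l * s $ j) z)"
      unfolding prod_UNIV_times_2 by (intro prod.cong refl) (simp add: \<xi> lens_factor_def)
    moreover have "norm (\<xi> l i * z) < 1" for i using assms(2) by (simp add: norm_mult norm_\<xi>)
    ultimately show ?thesis using has_sum_prod_geometric[of "\<lambda>i. \<xi> l i * z"] by metis
  qed
  then have "((\<lambda>\<alpha>. \<Sum>l<q. \<Prod>i\<in>UNIV. (\<xi> l i * z) ^ \<alpha> i) has_sum
      (\<Sum>l<q. \<Prod>j\<in>UNIV. 1 / lens_factor q (int l * s $ j) z)) UNIV"
    by (rule has_sum_sum_finite)
  moreover have "(\<Sum>l<q. \<Prod>i\<in>UNIV. (\<xi> l i * z) ^ \<alpha> i) =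
      (if int q dvd weight s \<alpha> then of_nat q * z ^ (\<Sum>i\<in>UNIV. \<alpha> i) else 0)" for \<alpha>
  proof -
    have "(\<Sum>l<q. \<Prod>i\<in>UNIV. (\<xi> l i * z) ^ \<alpha> i) =
        (\<Sum>l<q. cis (- 2 * pi * of_int (int l * weight s \<alpha>) / of_nat q)) * z ^ (\<Sum>i\<in>UNIV. \<alpha> i)"
      by (simp only: power_mult_distrib prod.distrib prod_\<xi> power_sum[symmetric] sum_distrib_right)
    then show ?thesis unfolding sum_cis_powers[OF assms(1)] by simp
  qed
  ultimately have "((\<lambda>\<alpha>. if int q dvd weight s \<alpha> then of_nat q * z ^ (\<Sum>i\<in>UNIV. \<alpha> i) else 0) has_sum
      (\<Sum>l<q. \<Prod>j\<in>UNIV. 1 / lens_factor q (int l * s $ j) z)) UNIV"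
    by simp
  then have "((\<lambda>\<alpha>. of_nat q * z ^ (\<Sum>i\<in>UNIV. \<alpha> i)) has_sum
      (\<Sum>l<q. \<Prod>j\<in>UNIV. 1 / lens_factor q (int l * s $ j) z)) {\<alpha>. int q dvd weight s \<alpha>}"
    by (rule has_sum_cong_neutral[THEN iffD1, rotated 3]) auto
  \<comment> \<open>Pairing each invariant exponent vector with its degree lists it once and lets
    the sum be collected by degree.\<close>
  moreover have "{\<alpha>. int q dvd weight s \<alpha>} = snd ` Sigma UNIV (weighted_exponents q s)"
    by (force simp: weighted_exponents_def exponents_def)
  moreover have "inj_on snd (Sigma UNIV (weighted_exponents q s))"
    by (auto simp: inj_on_def weighted_exponents_def exponents_def)
  ultimately have "((\<lambda>p. of_nat q * z ^ (\<Sum>i\<in>UNIV. snd p i)) has_sum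
      (\<Sum>l<q. \<Prod>j\<in>UNIV. 1 / lens_factor q (int l * s $ j) z)) (Sigma UNIV (weighted_exponents q s))"
    by (simp add: has_sum_reindex o_def)
  then show ?thesis
  proof (rule has_sum_SigmaD)
    fix k :: nat
    have "(\<Sum>\<alpha>\<in>weighted_exponents q s k. of_nat q * z ^ (\<Sum>i\<in>UNIV. \<alpha> i)) =
        (\<Sum>\<alpha>\<in>weighted_exponents q s k. of_nat q * z ^ k)"
      by (rule sum.cong) (auto simp: weighted_exponents_def exponents_def)
    then show "((\<lambda>\<alpha>. of_nat q * z ^ (\<Sum>i\<in>UNIV. snd (k, \<alpha>) i)) has_sum
        of_nat (q * card (weighted_exponents q s k)) * z ^ k) (weighted_exponents q s k)"
      using has_sum_finite[OF finite_weighted_exponents[of q s k], of "\<lambda>\<alpha>. of_nat q * z ^ (\<Sum>i\<in>UNIV. \<alpha> i)"]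
      by (simp add: mult_ac)
  qed
qed

lemma isospectral_imp_sum_lens_factor_eq:
  fixes s :: "int^'n" and t :: "int^'m"
  assumes "q > 0" and "isospectral (lens_group q s) (lens_group q t)" and "norm z < 1"
  shows "(\<Sum>l<q. \<Prod>j\<in>UNIV. 1 / lens_factor q (int l * s $ j) z) =
    (\<Sum>l<q. \<Prod>j\<in>UNIV. 1 / lens_factor q (int l * t $ j) z)"
  using has_sum_weighted_exponents[OF assms(1,3), of s] has_sum_weighted_exponents[OF assms(1,3), of t]
  unfolding isospectral_imp_card_weighted_exponents_eq[OF assms(1,2)]
  by (rule has_sum_unique)

section \<open>Poles of the generating function\<close>

text \<open>The representative of the class \<open>\<plusminus>c\<close> modulo \<open>q\<close> in \<open>{0..q div 2}\<close>.\<close>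

definition unsigned_residue :: "nat \<Rightarrow> int \<Rightarrow> nat" where
  "unsigned_residue q c = nat (min (c mod int q) (- c mod int q))"

lemma unsigned_residue_cases:
  assumes "q > 0"
  obtains "int q dvd c - int (unsigned_residue q c)" | "int q dvd c + int (unsigned_residue q c)"
proof -
  have pos: "0 \<le> c mod int q" "0 \<le> - c mod int q" using assms by simp_all
  have "int q dvd c - c mod int q" by (simp add: dvd_minus_mod)
  moreover have "int q dvd c + (- c mod int q)"
    using dvd_minus_mod[of "int q" "- c"] by (metis add.commute add.inverse_inverse diff_minus_eq_add dvd_minus_iff minus_diff_eq)
  moreover have "int (unsigned_residue q c) = c mod int q \<or> int (unsigned_residue q c) = - c mod int q"
    using pos by (simp add: unsigned_residue_def min_def)
  ultimately show ?thesis using that by metis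
qed

lemma unsigned_residue_le:
  assumes "q > 0"
  shows "2 * unsigned_residue q c \<le> q"
proof -
  have "c mod int q + - c mod int q \<le> int q"
    using assms zmod_zminus1_eq_if[of c "int q"] by auto
  then have "2 * min (c mod int q) (- c mod int q) \<le> int q" by linarith
  then show ?thesis unfolding unsigned_residue_def by linarith
qed

lemma unsigned_residue_minus: "unsigned_residue q (- c) = unsigned_residue q c"
  by (simp add: unsigned_residue_def min.commute)

lemma unsigned_residue_cong: "int q dvd c - d \<Longrightarrow> unsigned_residue q c = unsigned_residue q d"
  unfolding unsigned_residue_def by (metis mod_eq_dvd_iff mod_minus_cong)

lemma unsigned_residue_eq_iff:
  assumes "q > 0"
  shows "unsigned_residue q c = unsigned_residue q d \<longleftrightarrow> int q dvd c - d \<or> int q dvd c + d"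
proof
  assume eq: "unsigned_residue q c = unsigned_residue q d"
  show "int q dvd c - d \<or> int q dvd c + d"
    by (rule unsigned_residue_cases[OF assms, of c]; rule unsigned_residue_cases[OF assms, of d];
        unfold eq; drule (1) dvd_diff[rotated] dvd_add[rotated]; simp add: algebra_simps)
next
  assume "int q dvd c - d \<or> int q dvd c + d"
  then show "unsigned_residue q c = unsigned_residue q d"
    using unsigned_residue_cong[of q c d] unsigned_residue_cong[of q c "- d"]
    by (auto simp: unsigned_residue_minus)
qed

lemma unsigned_residue_mult:
  assumes "q > 0"
  shows "unsigned_residue q (l * c) = unsigned_residue q (l * int (unsigned_residue q c))"
  unfolding unsigned_residue_eq_iff[OF assms]
  by (rule unsigned_residue_cases[OF assms, of c])
     (simp_all add: dvd_mult flip: right_diff_distrib distrib_left)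

lemma unsigned_residue_mult_cong:
  assumes "q > 0" "unsigned_residue q l = unsigned_residue q l'"
  shows "unsigned_residue q (l * c) = unsigned_residue q (l' * c)"
  using assms(2) unsigned_residue_mult[OF assms(1), of c l] unsigned_residue_mult[OF assms(1), of c l']
  by (simp add: mult.commute)

lemma coprime_unsigned_residue:
  assumes "q > 0" "coprime (int q) c"
  shows "coprime q (unsigned_residue q c)"
proof -
  let ?u = "int (unsigned_residue q c)"
  have "coprime (int q) ?u"
  proof (rule coprimeI)
    fix d assume d: "d dvd int q" "d dvd ?u"
    have "d dvd c"
      by (rule unsigned_residue_cases[OF assms(1), of c])
         (metis d dvd_trans dvd_diff_right_iff dvd_add_left_iff dvd_diff_left_iff)+
    with d(1) assms(2) show "is_unit d" by (meson coprime_common_divisor)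
  qed
  then show ?thesis by simp
qed

text \<open>\<open>lens_factor\<close> multiplied out: only the cosine survives, so the factor
  depends on its residue up to sign.\<close>

definition root_factor :: "nat \<Rightarrow> nat \<Rightarrow> complex \<Rightarrow> complex" where
  "root_factor q u z = 1 - of_real (2 * cos (2 * pi * real u / real q)) * z + z ^ 2"

lemma cos_unsigned_residue:
  assumes "q > 0"
  shows "cos (2 * pi * of_int c / real q) = cos (2 * pi * real (unsigned_residue q c) / real q)"
proof -
  let ?u = "int (unsigned_residue q c)"
  have "cos (2 * pi * of_int c / real q) = cos (2 * pi * of_int ?u / real q)"
  proof (rule unsigned_residue_cases[OF assms, of c])
    assume "int q dvd c - ?u"
    then obtain m where "c = ?u + int q * m" by (metis add.commute diff_add_cancel dvd_def)
    then have "real_of_int c = of_int ?u + real q * of_int m"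
      by (metis of_int_add of_int_mult of_int_of_nat_eq)
    then have "2 * pi * of_int c / real q = 2 * pi * (of_int ?u + real q * of_int m) / real q"
      by (simp only:)
    also have "\<dots> = 2 * pi * of_int ?u / real q + 2 * pi * of_int m"
      using assms by (simp add: field_simps)
    finally have "2 * pi * of_int c / real q = 2 * pi * of_int ?u / real q + 2 * pi * of_int m" .
    then show ?thesis by (simp only: cos_add cos_int_2pin sin_int_2pin mult_1_right mult_zero_right diff_zero)
  next
    assume "int q dvd c + ?u"
    then obtain m where "c = - ?u + int q * m" by (metis add.commute add_minus_cancel dvd_def)
    then have "real_of_int c = - of_int ?u + real q * of_int m"
      by (metis of_int_add of_int_mult of_int_of_nat_eq of_int_minus)
    then have "2 * pi * of_int c / real q = 2 * pi * (- of_int ?u + real q * of_int m) / real q"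
      by (simp only:)
    also have "\<dots> = - (2 * pi * of_int ?u / real q) + 2 * pi * of_int m"
      using assms by (simp add: field_simps)
    finally have "2 * pi * of_int c / real q = - (2 * pi * of_int ?u / real q) + 2 * pi * of_int m" .
    then show ?thesis by (simp only: cos_add cos_int_2pin sin_int_2pin) simp
  qed
  then show ?thesis by simp
qed

lemma lens_factor_eq_root_factor:
  assumes "q > 0"
  shows "lens_factor q c z = root_factor q (unsigned_residue q c) z"
proof -
  let ?\<theta> = "2 * pi * of_int c / real q"
  have "cis ?\<theta> + cis (- ?\<theta>) = of_real (2 * cos ?\<theta>)" by (simp add: complex_eq_iff)
  moreover have "cis ?\<theta> * cis (- ?\<theta>) = 1" by (simp add: cis_mult)
  moreover have "(1 - a * z) * (1 - b * z) = 1 - (a + b) * z + a * b * z ^ 2" for a b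
    by (simp add: algebra_simps power2_eq_square)
  ultimately show ?thesis
    unfolding lens_factor_def root_factor_def cos_unsigned_residue[OF assms, of c, symmetric] by simp
qed

lemma lens_factor_nonzero:
  assumes "norm z < 1"
  shows "lens_factor q c z \<noteq> 0"
proof -
  have "1 - cis \<theta> * z \<noteq> 0" for \<theta>
  proof
    assume "1 - cis \<theta> * z = 0"
    then have "norm (cis \<theta> * z) = 1" by simp
    with assms show False by (simp add: norm_mult)
  qed
  then show ?thesis by (simp add: lens_factor_def)
qed

text \<open>On the unit circle z + 1/z is real, so \<open>root_factor q u\<close> at zeta is zeta
  times a real number, namely this one.\<close>

definition root_gap :: "nat \<Rightarrow> nat \<Rightarrow> real" where
  "root_gap q u = 2 * (cos (2 * pi / real q) - cos (2 * pi * real u / real q))"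

lemma root_factor_at_root: "root_factor q u (cis (2 * pi / real q)) = cis (2 * pi / real q) * of_real (root_gap q u)"
proof -
  let ?w = "cis (2 * pi / real q)"
  have "1 + ?w ^ 2 = ?w * (?w + cis (- (2 * pi / real q)))"
    by (simp add: distrib_left cis_mult power2_eq_square)
  also have "?w + cis (- (2 * pi / real q)) = of_real (2 * cos (2 * pi / real q))"
    by (simp add: complex_eq_iff)
  finally show ?thesis by (simp add: root_factor_def root_gap_def algebra_simps)
qed

lemma cos_strict_antimono_residue:
  assumes "u < v" "2 * v \<le> q"
  shows "cos (2 * pi * real v / real q) < cos (2 * pi * real u / real q)"
proof (rule cos_monotone_0_pi)
  have q: "real q > 0" using assms by simp
  show "0 \<le> 2 * pi * real u / real q" by simp
  show "2 * pi * real u / real q < 2 * pi * real v / real q"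
    using assms(1) q by (intro divide_strict_right_mono) auto
  have "2 * real v \<le> real q" using assms(2) by linarith
  then have "pi * (2 * real v) \<le> pi * real q" by (intro mult_left_mono) auto
  then show "2 * pi * real v / real q \<le> pi" using q by (simp add: pos_divide_le_eq mult_ac)
qed

lemma root_gap_1: "root_gap q 1 = 0"
  by (simp add: root_gap_def)

lemma root_gap_strict_mono: "u < v \<Longrightarrow> 2 * v \<le> q \<Longrightarrow> root_gap q u < root_gap q v"
  using cos_strict_antimono_residue[of u v q] by (simp add: root_gap_def)

lemma root_gap_pos: "1 < u \<Longrightarrow> 2 * u \<le> q \<Longrightarrow> root_gap q u > 0"
  using root_gap_strict_mono[of 1 u q] root_gap_1[of q] by simp

text \<open>Includes u = 0, where the gap is negative: the limit at zeta involves every l, also l =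
  0.\<close>

lemma root_gap_nonzero: "u \<noteq> 1 \<Longrightarrow> 2 * u \<le> q \<Longrightarrow> 2 \<le> q \<Longrightarrow> root_gap q u \<noteq> 0"
  using root_gap_strict_mono[of 1 u q] root_gap_strict_mono[of u 1 q]
  by (cases "u < 1") (auto simp: root_gap_1[unfolded One_nat_def])

text \<open>The pole order of the l-th summand at zeta, counted in factors
  \<open>root_factor q 1\<close>.\<close>

definition multiplicity_at :: "nat \<Rightarrow> int^'n \<Rightarrow> int \<Rightarrow> nat" where
  "multiplicity_at q s l = card {j. unsigned_residue q (l * s $ j) = 1}"

text \<open>The coefficient of the pole of order \<open>M\<close> at \<open>\<zeta>\<close> of the \<open>l\<close>-th summand, up to a factor depending
  only on \<open>M\<close> and the dimension.\<close>

definition pole_coefficient :: "nat \<Rightarrow> int^'n \<Rightarrow> nat \<Rightarrow> int \<Rightarrow> real" where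
  "pole_coefficient q s M l = (if multiplicity_at q s l = M
     then (\<Prod>j | unsigned_residue q (l * s $ j) \<noteq> 1. 1 / root_gap q (unsigned_residue q (l * s $ j))) else 0)"

text \<open>The generating function is available only inside the unit disc, so zeta is approached
  radially. After scaling by the M-th power of the vanishing factor, summands with fewer vanishing
  factors tend to 0.\<close>

lemma tendsto_scaled_lens_sum:
  fixes s :: "int^'n"
  assumes q: "2 \<le> q" and M: "\<And>l. l < q \<Longrightarrow> multiplicity_at q s (int l) \<le> M"
  defines "\<omega> \<equiv> cis (2 * pi / real q)"
  shows "((\<lambda>r. root_factor q 1 (of_real r * \<omega>) ^ M *
        (\<Sum>l<q. \<Prod>j\<in>UNIV. 1 / lens_factor q (int l * s $ j) (of_real r * \<omega>)))
      \<longlongrightarrow> of_real (\<Sum>l<q. pole_coefficient q s M (int l)) / \<omega> ^ (CARD('n) - M)) (at_left 1)"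
proof -
  have q0: "q > 0" using q by simp
  define u where "u l j = unsigned_residue q (int l * s $ j)" for l j
  define N where "N l = multiplicity_at q s (int l)" for l
  have card_ne: "card {j. u l j \<noteq> 1} = CARD('n) - N l" for l
    using card_Diff_subset[of "{j. u l j = 1}" UNIV]
    by (simp add: N_def multiplicity_at_def u_def set_diff_eq)
  \<comment> \<open>The scaled sum with vanishing factors cancelled: equal to the original inside
    the disc and continuous at zeta.\<close>
  define G where "G z = (\<Sum>l<q. root_factor q 1 z ^ (M - N l) * (\<Prod>j | u l j \<noteq> 1. 1 / root_factor q (u l j) z))" for z
  have eq: "root_factor q 1 z ^ M * (\<Sum>l<q. \<Prod>j\<in>UNIV. 1 / lens_factor q (int l * s $ j) z) = G z"
    if z: "norm z < 1" for z
  proof -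
    have one: "unsigned_residue q 1 = 1" using q by (cases "q = 2") (auto simp: unsigned_residue_def zmod_minus1 min_def)
    have nz: "root_factor q 1 z \<noteq> 0"
      using lens_factor_nonzero[OF z, of q 1] by (simp add: lens_factor_eq_root_factor[OF q0] one)
    have "root_factor q 1 z ^ M * (\<Prod>j\<in>UNIV. 1 / lens_factor q (int l * s $ j) z) =
        root_factor q 1 z ^ (M - N l) * (\<Prod>j | u l j \<noteq> 1. 1 / root_factor q (u l j) z)" if "l < q" for l
    proof -
      have "(\<Prod>j\<in>UNIV. 1 / lens_factor q (int l * s $ j) z) = (\<Prod>j\<in>UNIV. 1 / root_factor q (u l j) z)"
        by (simp add: lens_factor_eq_root_factor[OF q0] u_def)
      also have "\<dots> = (\<Prod>j\<in>{j. u l j = 1} \<union> {j. u l j \<noteq> 1}. 1 / root_factor q (u l j) z)"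
        by (rule prod.cong) auto
      also have "\<dots> = (\<Prod>j | u l j = 1. 1 / root_factor q (u l j) z) * (\<Prod>j | u l j \<noteq> 1. 1 / root_factor q (u l j) z)"
        by (rule prod.union_disjoint) auto
      also have "(\<Prod>j | u l j = 1. 1 / root_factor q (u l j) z) = (1 / root_factor q 1 z) ^ N l"
        by (simp add: N_def multiplicity_at_def u_def)
      finally show ?thesis
        using nz M[OF that] by (simp add: N_def power_diff power_one_over field_simps)
    qed
    then show ?thesis by (simp add: G_def sum_distrib_left)
  qed
  have nz: "root_factor q (u l j) \<omega> \<noteq> 0" if "u l j \<noteq> 1" for l j
    using root_gap_nonzero[OF that _ q] unsigned_residue_le[OF q0] unfolding u_def \<omega>_def
    by (simp add: root_factor_at_root)
  have "isCont G \<omega>"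
    unfolding G_def root_factor_def
    by (intro continuous_intros) (use nz in \<open>auto simp: root_factor_def\<close>)
  moreover have "((\<lambda>r. of_real r * \<omega>) \<longlongrightarrow> of_real 1 * \<omega>) (at_left 1)"
    by (intro tendsto_intros)
  ultimately have lim: "((\<lambda>r. G (of_real r * \<omega>)) \<longlongrightarrow> G \<omega>) (at_left 1)"
    using isCont_tendsto_compose by fastforce
  have "eventually (\<lambda>r. r \<in> {0<..<1::real}) (at_left 1)"
    by (rule eventually_at_left_real) simp
  then have ev: "eventually (\<lambda>r. G (of_real r * \<omega>) = root_factor q 1 (of_real r * \<omega>) ^ M *
        (\<Sum>l<q. \<Prod>j\<in>UNIV. 1 / lens_factor q (int l * s $ j) (of_real r * \<omega>))) (at_left 1)"
    by eventually_elim (rule eq[symmetric], simp add: norm_mult \<omega>_def)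
  have "G \<omega> = of_real (\<Sum>l<q. pole_coefficient q s M (int l)) / \<omega> ^ (CARD('n) - M)"
  proof -
    have "root_factor q 1 \<omega> = 0" by (simp only: \<omega>_def root_factor_at_root root_gap_1) simp
    then have "root_factor q 1 \<omega> ^ (M - N l) * (\<Prod>j | u l j \<noteq> 1. 1 / root_factor q (u l j) \<omega>) =
        of_real (pole_coefficient q s M (int l)) / \<omega> ^ (CARD('n) - M)" if "l < q" for l
    proof (cases "N l = M")
      case True
      \<comment> \<open>Every surviving summand has exactly n - M nonvanishing factors, hence the
        same power of \<open>\<omega>\<close>; what remains is real.\<close>
      have "(\<Prod>j | u l j \<noteq> 1. 1 / root_factor q (u l j) \<omega>) =
          (\<Prod>j | u l j \<noteq> 1. of_real (1 / root_gap q (u l j)) * (1 / \<omega>))"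
        unfolding \<omega>_def root_factor_at_root by (intro prod.cong refl) simp
      also have "\<dots> = of_real (\<Prod>j | u l j \<noteq> 1. 1 / root_gap q (u l j)) * (1 / \<omega>) ^ (CARD('n) - M)"
        using True by (simp only: prod.distrib of_real_prod prod_constant card_ne)
      finally show ?thesis using True
        by (simp add: pole_coefficient_def N_def u_def divide_inverse power_inverse)
    next
      case False
      then show ?thesis using M[OF that] \<open>root_factor q 1 \<omega> = 0\<close>
        by (simp add: pole_coefficient_def N_def)
    qed
    then show ?thesis unfolding G_def by (simp add: sum_divide_distrib)
  qed
  with lim show ?thesis unfolding tendsto_cong[OF ev] by (simp only:)
qed

text \<open>Equality of the dimensions makes the power of zeta the same in both limits, so it
  cancels.\<close>

lemma isospectral_imp_sum_pole_coefficient_eq: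
  fixes s :: "int^'n" and t :: "int^'m"
  assumes q: "2 \<le> q" and iso: "isospectral (lens_group q s) (lens_group q t)"
    and s: "\<And>l. l < q \<Longrightarrow> multiplicity_at q s (int l) \<le> M"
    and t: "\<And>l. l < q \<Longrightarrow> multiplicity_at q t (int l) \<le> M"
  shows "(\<Sum>l<q. pole_coefficient q s M (int l)) = (\<Sum>l<q. pole_coefficient q t M (int l))"
proof -
  have q0: "q > 0" using q by simp
  let ?w = "cis (2 * pi / real q)"
  have "eventually (\<lambda>r. r \<in> {0<..<1::real}) (at_left 1)"
    by (rule eventually_at_left_real) simp
  then have "eventually (\<lambda>r. root_factor q 1 (of_real r * ?w) ^ M *
        (\<Sum>l<q. \<Prod>j\<in>UNIV. 1 / lens_factor q (int l * s $ j) (of_real r * ?w)) =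
      root_factor q 1 (of_real r * ?w) ^ M *
        (\<Sum>l<q. \<Prod>j\<in>UNIV. 1 / lens_factor q (int l * t $ j) (of_real r * ?w))) (at_left 1)"
    by eventually_elim (subst isospectral_imp_sum_lens_factor_eq[OF q0 iso], simp_all add: norm_mult)
  from tendsto_unique[OF _ tendsto_scaled_lens_sum[OF q s, THEN tendsto_cong[OF this, THEN iffD1]]
      tendsto_scaled_lens_sum[OF q t]]
  show ?thesis
    by (simp add: isospectral_imp_CARD_eq[OF q0 iso] del: of_real_sum)
qed

lemma multiplicity_at_cong:
  assumes "q > 0" "unsigned_residue q l = unsigned_residue q l'"
  shows "multiplicity_at q s l = multiplicity_at q s l'"
  by (simp add: multiplicity_at_def unsigned_residue_mult_cong[OF assms])

lemma pole_coefficient_cong: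
  assumes "q > 0" "unsigned_residue q l = unsigned_residue q l'"
  shows "pole_coefficient q s M l = pole_coefficient q s M l'"
  by (simp add: pole_coefficient_def multiplicity_at_cong[OF assms] unsigned_residue_mult_cong[OF assms])

section \<open>Isometries of lens spaces\<close>

lemma Ck_on_const: "Ck_on k W (\<lambda>_. a)"
  by (induction k arbitrary: a) auto

lemma smooth_on_linear:
  fixes g :: "'a::euclidean_space \<Rightarrow> 'b::real_normed_vector"
  assumes "bounded_linear g" and "open W"
  shows "smooth_on W g"
proof -
  have d: "frechet_derivative g (at x) = g" for x
    using frechet_derivative_at[OF bounded_linear_imp_has_derivative[OF assms(1)]] by simp
  have "Ck_on k W g" for k
  proof (cases k)
    case 0
    then show ?thesis using assms(1) by (simp add: linear_continuous_on)
  next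
    case (Suc m)
    then show ?thesis using bounded_linear_imp_has_derivative[OF assms(1)]
      by (auto simp: d Ck_on_const differentiable_def)
  qed
  then show ?thesis using assms(2) by (simp add: smooth_on_def)
qed

lemma preserves_metric_linear:
  fixes g :: "real^'d \<Rightarrow> real^'e"
  assumes g: "linear g" and inner: "\<And>x y. g x \<bullet> g y = x \<bullet> y"
    and F: "\<And>y. y \<in> sphere 0 1 \<Longrightarrow> F (orbit \<Gamma> y) = orbit \<Gamma>' (g y)"
  shows "preserves_metric \<Gamma> \<Gamma>' F"
proof -
  have bl: "bounded_linear g" using g linear_conv_bounded_linear by blast
  have d: "frechet_derivative g (at x) = g" for x
    using frechet_derivative_at[OF bounded_linear_imp_has_derivative[OF bl]] by simp
  have norm: "norm (g y) = norm y" for y by (simp add: norm_eq_sqrt_inner inner)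
  show ?thesis
    unfolding preserves_metric_def
    by (intro ballI exI[of _ UNIV] exI[of _ g] conjI smooth_on_linear[OF bl])
       (simp_all add: d norm F inner)
qed

text \<open>A linear isometry taking orbits to orbits induces a map of quotients by images and is
  itself a global smooth lift of it; \<open>h\<close> does the same for the inverse.\<close>

lemma isometric_of_linear:
  fixes g :: "real^'d \<Rightarrow> real^'e" and h :: "real^'e \<Rightarrow> real^'d"
  assumes g: "linear g" "\<And>x y. g x \<bullet> g y = x \<bullet> y" and h: "linear h" "\<And>x y. h x \<bullet> h y = x \<bullet> y"
    and hg: "\<And>x. h (g x) = x" and gh: "\<And>y. g (h y) = y"
    and orbit: "\<And>x. g ` orbit \<Gamma> x = orbit \<Gamma>' (g x)"
  shows "isometric \<Gamma> \<Gamma>'"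
proof -
  have norm: "norm (g x) = norm x" for x by (simp add: norm_eq_sqrt_inner g)
  have norm': "norm (h x) = norm x" for x by (simp add: norm_eq_sqrt_inner h)
  have inj: "inj_on ((`) g) A" for A
    by (metis hg inj_def inj_image_eq_iff inj_onI)
  have bij: "bij_betw ((`) g) (sphere_quotient \<Gamma>) (sphere_quotient \<Gamma>')"
  proof (rule bij_betw_imageI[OF inj])
    have "sphere 0 1 = g ` sphere 0 1"
    proof (intro equalityI subsetI)
      fix y :: "real^'e" assume "y \<in> sphere 0 1"
      then show "y \<in> g ` sphere 0 1" using gh[of y] norm'[of y] by (intro image_eqI[of _ _ "h y"]) auto
    qed (auto simp: norm)
    then show "(`) g ` sphere_quotient \<Gamma> = sphere_quotient \<Gamma>'"
      unfolding sphere_quotient_def image_image orbit by (metis image_image)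
  qed
  have "inv_into (sphere_quotient \<Gamma>) ((`) g) (orbit \<Gamma>' y) = orbit \<Gamma> (h y)" if "y \<in> sphere 0 1" for y
  proof -
    have "orbit \<Gamma> (h y) \<in> sphere_quotient \<Gamma>"
      using that norm'[of y] by (auto simp: sphere_quotient_def)
    from inv_into_f_f[OF inj this] show ?thesis by (simp add: orbit gh)
  qed
  then have "preserves_metric \<Gamma>' \<Gamma> (inv_into (sphere_quotient \<Gamma>) ((`) g))"
    by (rule preserves_metric_linear[OF h])
  moreover have "preserves_metric \<Gamma> \<Gamma>' ((`) g)"
    by (rule preserves_metric_linear[OF g]) (rule orbit)
  ultimately show ?thesis using bij unfolding isometric_def by blast
qed

text \<open>The values of \<open>\<epsilon>\<close> are signs: -1 conjugates a block, which reverses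
  its rotation and so negates the parameter.\<close>

definition permute_blocks :: "('m \<Rightarrow> 'n) \<Rightarrow> ('m \<Rightarrow> real) \<Rightarrow> real^('n::finite \<times> 2) \<Rightarrow> real^('m::finite \<times> 2)" where
  "permute_blocks \<tau> \<epsilon> x =
     (\<chi> i. (if snd i = 1 then 1 else \<epsilon> (fst i)) * x $ (\<tau> (fst i), snd i))"

lemma linear_permute_blocks: "linear (permute_blocks \<tau> \<epsilon>)"
  by (rule linearI) (simp_all add: permute_blocks_def vec_eq_iff algebra_simps)

lemma inner_permute_blocks:
  assumes "bij \<tau>" and "\<And>j. \<epsilon> j * \<epsilon> j = 1"
  shows "permute_blocks \<tau> \<epsilon> x \<bullet> permute_blocks \<tau> \<epsilon> y = x \<bullet> y"
proof -
  have sq: "\<epsilon> j * a * (\<epsilon> j * b) = a * b" for j a b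
    using assms(2)[of j] by (metis mult.assoc mult.left_commute mult_1)
  have "permute_blocks \<tau> \<epsilon> x \<bullet> permute_blocks \<tau> \<epsilon> y =
      (\<Sum>j\<in>UNIV. x $ (\<tau> j, 1) * y $ (\<tau> j, 1) + x $ (\<tau> j, 2) * y $ (\<tau> j, 2))"
    by (simp add: inner_vec_def sum_UNIV_times_2 permute_blocks_def sq)
  also have "\<dots> = (\<Sum>j\<in>UNIV. x $ (j, 1) * y $ (j, 1) + x $ (j, 2) * y $ (j, 2))"
    by (rule sum.reindex_bij_betw[OF assms(1)])
  finally show ?thesis by (simp add: inner_vec_def sum_UNIV_times_2)
qed

lemma permute_blocks_inverse:
  assumes "\<And>j. \<tau> (\<sigma> j) = j" and "\<And>j. \<epsilon> (\<sigma> j) * \<epsilon>' j = 1"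
  shows "permute_blocks \<sigma> \<epsilon>' (permute_blocks \<tau> \<epsilon> x) = x"
proof (rule vec_eq_iff[THEN iffD2], rule allI)
  fix i
  show "permute_blocks \<sigma> \<epsilon>' (permute_blocks \<tau> \<epsilon> x) $ i = x $ i"
    using assms(1)[of "fst i"] assms(2)[of "fst i"]
    by (cases i) (simp add: permute_blocks_def mult.assoc[symmetric] mult.commute[of "\<epsilon>' _"])
qed

lemma permute_blocks_lens_generator:
  assumes "\<And>j. \<epsilon> j = of_int (e j)" and "\<And>j. e j * e j = 1"
  shows "permute_blocks \<tau> \<epsilon> (lens_generator q s *v x) =
    lens_generator q (\<chi> j. e j * s $ \<tau> j) *v permute_blocks \<tau> \<epsilon> x"
proof (rule vec_eq_iff[THEN iffD2], rule allI)
  fix i :: "'a \<times> 2"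
  obtain j a where i: "i = (j, a)" by force
  have "e j = 1 \<or> e j = - 1" using assms(2)[of j] by (auto simp: square_eq_1_iff)
  then show "permute_blocks \<tau> \<epsilon> (lens_generator q s *v x) $ i =
      (lens_generator q (\<chi> j. e j * s $ \<tau> j) *v permute_blocks \<tau> \<epsilon> x) $ i"
    using exhaust_2[of a] unfolding i
    by (elim disjE) (simp_all add: permute_blocks_def lens_generator_mult_vec assms(1))
qed

lemma obtain_bij_fibres:
  fixes f :: "'a::finite \<Rightarrow> 'c" and g :: "'b::finite \<Rightarrow> 'c"
  assumes "\<And>c. card {x. f x = c} = card {y. g y = c}"
  obtains \<sigma> where "bij \<sigma>" and "\<And>x. g (\<sigma> x) = f x"
proof -
  have "\<forall>c. \<exists>h. bij_betw h {x. f x = c} {y. g y = c}"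
    using assms by (intro allI finite_same_card_bij) auto
  then obtain h where h: "\<And>c. bij_betw (h c) {x. f x = c} {y. g y = c}" by metis
  define \<sigma> where "\<sigma> x = h (f x) x" for x
  have \<sigma>: "g (\<sigma> x) = f x" for x using bij_betwE[OF h[of "f x"]] by (simp add: \<sigma>_def)
  have "inj \<sigma>"
  proof (rule injI)
    fix x y assume eq: "\<sigma> x = \<sigma> y"
    then have "f x = f y" by (metis \<sigma>)
    with eq bij_betw_imp_inj_on[OF h[of "f x"]] show "x = y" by (auto simp: \<sigma>_def inj_on_def)
  qed
  moreover have "surj \<sigma>"
    unfolding surj_def
  proof
    fix y
    have "y \<in> h (g y) ` {x. f x = g y}" using bij_betw_imp_surj_on[OF h[of "g y"]] by simp
    then obtain x where "y = h (g y) x" "f x = g y" by auto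
    then show "\<exists>x. y = \<sigma> x" by (metis \<sigma>_def)
  qed
  ultimately show ?thesis using that[of \<sigma>] \<sigma> by (simp add: bij_def)
qed

lemma orbit_lens_group:
  "orbit (lens_group q s) x = range (\<lambda>k::int. lens_generator q (\<chi> j. k * s $ j) *v x)"
  by (simp add: orbit_def lens_group_eq image_image)

text \<open>Three changes of parameters are combined: scaling by a unit changes the generator but
  not the group, negating an entry conjugates a block, and reordering permutes blocks.\<close>

lemma isometric_lens_groups:
  fixes s :: "int^'n" and t :: "int^'m"
  assumes q: "q > 0" and l: "coprime (int q) l"
    and card: "\<And>c. card {j. unsigned_residue q (l * s $ j) = c} = card {j. unsigned_residue q (t $ j) = c}"
  shows "isometric (lens_group q s) (lens_group q t)"
proof -
  obtain \<sigma> where \<sigma>: "bij \<sigma>" "\<And>j. unsigned_residue q (t $ \<sigma> j) = unsigned_residue q (l * s $ j)"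
    using obtain_bij_fibres[OF card] by metis
  define \<tau> where "\<tau> = inv \<sigma>"
  have \<tau>: "bij \<tau>" "\<And>j. \<sigma> (\<tau> j) = j" "\<And>j. \<tau> (\<sigma> j) = j"
    using \<sigma>(1) by (simp_all add: \<tau>_def bij_imp_bij_inv surj_f_inv_f bij_is_surj bij_is_inj)
  define e :: "'m \<Rightarrow> int" where "e i = (if int q dvd t $ i - l * s $ \<tau> i then 1 else - 1)" for i
  have e: "int q dvd t $ i - l * (e i * s $ \<tau> i)" for i
    using \<sigma>(2)[of "\<tau> i"] by (auto simp: \<tau> e_def unsigned_residue_eq_iff[OF q])
  have ee: "e i * e i = 1" for i by (simp add: e_def)
  \<comment> \<open>An inverse of \<open>l\<close> modulo \<open>q\<close>: \<open>g\<close> turns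
    power k of one generator into power \<open>k * l'\<close> of the other, and \<open>k * l\<close>
    leads back.\<close>
  obtain l' where l': "int q dvd l * l' - 1"
  proof -
    obtain u v where "u * int q + v * l = 1" using bezout_int[of "int q" l] l by auto
    then have "l * v - 1 = int q * - u" by (simp add: algebra_simps)
    then show ?thesis using that by (metis dvd_triv_left)
  qed
  have e': "int q dvd e i * s $ \<tau> i - l' * t $ i" for i
  proof -
    have "e i * s $ \<tau> i - l' * t $ i =
        - (l * l' - 1) * (e i * s $ \<tau> i) - l' * (t $ i - l * (e i * s $ \<tau> i))"
      by (simp add: algebra_simps)
    then show ?thesis using l' e[of i] by (simp only: dvd_diff dvd_mult dvd_mult2 dvd_minus_iff)
  qed
  define g where "g = permute_blocks \<tau> (\<lambda>i. of_int (e i))"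
  define h where "h = permute_blocks \<sigma> (\<lambda>j. of_int (e (\<sigma> j)))"
  have ee_real: "real_of_int (e i) * of_int (e i) = 1" for i
    using ee[of i] by (metis of_int_1 of_int_mult)
  have g_gen: "g (lens_generator q (\<chi> j. k * s $ j) *v x) = lens_generator q (\<chi> i. e i * (k * s $ \<tau> i)) *v g x" for k x
    unfolding g_def by (subst permute_blocks_lens_generator[of _ e]) (simp_all add: ee)
  show ?thesis
  proof (rule isometric_of_linear)
    show "linear g" "linear h" by (simp_all add: g_def h_def linear_permute_blocks)
    show "g x \<bullet> g y = x \<bullet> y" for x y unfolding g_def by (rule inner_permute_blocks) (simp_all add: \<tau> ee_real)
    show "h x \<bullet> h y = x \<bullet> y" for x y unfolding h_def by (rule inner_permute_blocks) (simp_all add: \<sigma> ee_real)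
    show "h (g x) = x" for x unfolding g_def h_def by (rule permute_blocks_inverse) (simp_all add: \<tau> ee_real)
    show "g (h y) = y" for y unfolding g_def h_def by (rule permute_blocks_inverse) (simp_all add: \<tau> ee_real)
    show "g ` orbit (lens_group q s) x = orbit (lens_group q t) (g x)" for x
    proof -
      have fwd: "lens_generator q (\<chi> i. e i * (k * s $ \<tau> i)) = lens_generator q (\<chi> i. (k * l') * t $ i)" for k
      proof (rule lens_generator_cong[OF _ q])
        fix i
        have "e i * (k * s $ \<tau> i) - (k * l') * t $ i = k * (e i * s $ \<tau> i - l' * t $ i)"
          by (simp add: algebra_simps)
        then show "int q dvd (\<chi> i. e i * (k * s $ \<tau> i)) $ i - (\<chi> i. (k * l') * t $ i) $ i"
          using e'[of i] by simp
      qed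
      have bwd: "lens_generator q (\<chi> i. k * t $ i) = lens_generator q (\<chi> i. e i * ((k * l) * s $ \<tau> i))" for k
      proof (rule lens_generator_cong[OF _ q])
        fix i
        have "k * t $ i - e i * ((k * l) * s $ \<tau> i) = k * (t $ i - l * (e i * s $ \<tau> i))"
          by (simp add: algebra_simps)
        then show "int q dvd (\<chi> i. k * t $ i) $ i - (\<chi> i. e i * ((k * l) * s $ \<tau> i)) $ i"
          using e[of i] by simp
      qed
      show ?thesis
        unfolding orbit_lens_group image_image g_gen
      proof (intro equalityI image_subsetI)
        fix k :: int
        show "lens_generator q (\<chi> i. e i * (k * s $ \<tau> i)) *v g x \<in> range (\<lambda>k. lens_generator q (\<chi> i. k * t $ i) *v g x)"
          by (rule range_eqI[of _ _ "k * l'"]) (simp only: fwd)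
        show "lens_generator q (\<chi> i. k * t $ i) *v g x \<in> range (\<lambda>k. lens_generator q (\<chi> i. e i * (k * s $ \<tau> i)) *v g x)"
          by (rule range_eqI[of _ _ "k * l"]) (simp only: bwd)
      qed
    qed
  qed
qed

section \<open>Reconstruction of the parameters\<close>

lemma prod_fibres:
  fixes w :: "'a::finite \<Rightarrow> 'c" and f :: "'c \<Rightarrow> 'b::comm_monoid_mult"
  assumes "finite C" "range w \<subseteq> C"
  shows "(\<Prod>j\<in>UNIV. f (w j)) = (\<Prod>c\<in>C. f c ^ card {j. w j = c})"
proof -
  have "(\<Prod>j | w j = c. f (w j)) = f c ^ card {j. w j = c}" for c by simp
  then show ?thesis using prod.group[of UNIV C w "\<lambda>j. f (w j)"] assms by simp
qed

lemma card_fibres: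
  fixes w :: "'a::finite \<Rightarrow> 'c"
  assumes "finite C" "range w \<subseteq> C"
  shows "card {j. P (w j)} = (\<Sum>c\<in>C. if P c then card {j. w j = c} else 0)"
proof -
  have "card {j. P (w j)} = (\<Sum>j\<in>UNIV. if P (w j) then 1 else 0)"
    by (simp add: sum.If_cases)
  also have "\<dots> = (\<Sum>c\<in>C. \<Sum>j | w j = c. if P (w j) then 1 else 0)"
    using sum.group[of UNIV C w "\<lambda>j. if P (w j) then 1 else (0::nat)"] assms by simp
  also have "\<dots> = (\<Sum>c\<in>C. if P c then card {j. w j = c} else 0)"
    by (intro sum.cong) auto
  finally show ?thesis .
qed

text \<open>The units modulo \<open>q\<close> up to sign; \<open>2 * c \<le> q\<close> selects one
  of c and q - c.\<close>

definition unit_residues :: "nat \<Rightarrow> nat set" where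
  "unit_residues q = {c. 2 * c \<le> q \<and> coprime q c}"

definition residue_count :: "nat \<Rightarrow> int^'n \<Rightarrow> nat \<Rightarrow> nat" where
  "residue_count q s c = card {j. unsigned_residue q (s $ j) = c}"

lemma finite_unit_residues: "finite (unit_residues q)"
  by (rule finite_subset[of _ "{..q}"]) (auto simp: unit_residues_def)

lemma unsigned_residue_in_unit_residues:
  "q > 0 \<Longrightarrow> coprime (int q) c \<Longrightarrow> unsigned_residue q c \<in> unit_residues q"
  by (simp add: unit_residues_def unsigned_residue_le coprime_unsigned_residue)

lemma unsigned_residue_of_nat:
  assumes "q > 0" "2 * c \<le> q"
  shows "unsigned_residue q (int c) = c"
proof (cases "c = 0")
  case False
  then have "int c mod int q = int c" "- int c mod int q = int q - int c"
    using assms by (simp_all add: zmod_zminus1_eq_if)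
  then show ?thesis using assms by (simp add: unsigned_residue_def)
qed (simp add: unsigned_residue_def)

context
  fixes q :: nat and s :: "int^'n"
  assumes q: "2 \<le> q" and s: "\<forall>j. coprime (int q) (s $ j)"
begin

lemma card_unsigned_residue_mult:
  "card {j. P (unsigned_residue q (l * s $ j))} =
     (\<Sum>c\<in>unit_residues q. if P (unsigned_residue q (l * int c)) then residue_count q s c else 0)"
proof -
  have q0: "q > 0" using q by simp
  have "card {j. P (unsigned_residue q (l * s $ j))} =
      card {j. P (unsigned_residue q (l * int (unsigned_residue q (s $ j))))}"
    by (simp add: unsigned_residue_mult[OF q0, symmetric])
  also have "\<dots> = (\<Sum>c\<in>unit_residues q. if P (unsigned_residue q (l * int c)) then residue_count q s c else 0)"
    unfolding residue_count_def
    by (rule card_fibres[OF finite_unit_residues, of _ _ "\<lambda>c. P (unsigned_residue q (l * int c))"])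
       (use s q0 in \<open>auto intro: unsigned_residue_in_unit_residues\<close>)
  finally show ?thesis .
qed

lemma sum_residue_count: "(\<Sum>c\<in>unit_residues q. residue_count q s c) = CARD('n)"
  using card_unsigned_residue_mult[of "\<lambda>_. True" 1] by simp

lemma multiplicity_at_eq:
  "multiplicity_at q s l =
     (\<Sum>c\<in>unit_residues q. if unsigned_residue q (l * int c) = 1 then residue_count q s c else 0)"
  unfolding multiplicity_at_def by (rule card_unsigned_residue_mult)

lemma pole_coefficient_eq:
  "pole_coefficient q s M l = (if multiplicity_at q s l = M then
     (\<Prod>c\<in>unit_residues q. (if unsigned_residue q (l * int c) = 1 then 1
        else 1 / root_gap q (unsigned_residue q (l * int c))) ^ residue_count q s c) else 0)"
proof -
  have q0: "q > 0" using q by simp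
  let ?f = "\<lambda>u. if u = 1 then 1 else 1 / root_gap q u"
  have "(\<Prod>j | unsigned_residue q (l * s $ j) \<noteq> 1. 1 / root_gap q (unsigned_residue q (l * s $ j))) =
      (\<Prod>j\<in>UNIV. ?f (unsigned_residue q (l * s $ j)))"
    by (rule prod.mono_neutral_cong_left) auto
  also have "\<dots> = (\<Prod>j\<in>UNIV. ?f (unsigned_residue q (l * int (unsigned_residue q (s $ j)))))"
    by (simp only: unsigned_residue_mult[OF q0, symmetric])
  also have "\<dots> = (\<Prod>c\<in>unit_residues q. ?f (unsigned_residue q (l * int c)) ^ residue_count q s c)"
    unfolding residue_count_def
    by (rule prod_fibres[OF finite_unit_residues, of _ _ "\<lambda>c. ?f (unsigned_residue q (l * int c))"])
       (use s q0 in \<open>auto intro: unsigned_residue_in_unit_residues\<close>)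
  finally show ?thesis unfolding pole_coefficient_def by simp
qed

text \<open>If l s_j is 1 or -1 modulo \<open>q\<close>, then l is a unit; so all other summands are
  regular at zeta.\<close>

lemma multiplicity_at_nonunit:
  assumes "unsigned_residue q l \<notin> unit_residues q"
  shows "multiplicity_at q s l = 0"
proof -
  have q0: "q > 0" using q by simp
  have "unsigned_residue q (l * s $ j) \<noteq> 1" for j
  proof
    assume "unsigned_residue q (l * s $ j) = 1"
    then have "int q dvd l * s $ j - 1 \<or> int q dvd l * s $ j + 1"
      using unsigned_residue_cases[OF q0, of "l * s $ j"] by auto
    have "coprime (int q) l"
    proof (rule coprimeI)
      fix d assume d: "d dvd int q" "d dvd l"
      then have "d dvd l * s $ j - 1 \<or> d dvd l * s $ j + 1"
        using \<open>int q dvd l * s $ j - 1 \<or> int q dvd l * s $ j + 1\<close> dvd_trans by blast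
      moreover have "d dvd l * s $ j" using d(2) by simp
      ultimately show "is_unit d" by (metis dvd_add_right_iff dvd_diff_right_iff)
    qed
    then show False using assms unsigned_residue_in_unit_residues[OF q0] by blast
  qed
  then show ?thesis by (simp add: multiplicity_at_def)
qed

lemma sum_pole_coefficient:
  assumes "M > 0"
  shows "(\<Sum>l<q. pole_coefficient q s M (int l)) =
    (\<Sum>l<q. if unsigned_residue q (int l) \<in> unit_residues q
       then pole_coefficient q s M (int (unsigned_residue q (int l))) else 0)"
proof (rule sum.cong[OF refl])
  have q0: "q > 0" using q by simp
  fix l
  have "unsigned_residue q (int l) = unsigned_residue q (int (unsigned_residue q (int l)))"
    by (simp add: unsigned_residue_of_nat unsigned_residue_le q0)
  note cong = pole_coefficient_cong[OF q0 this]
  show "pole_coefficient q s M (int l) = (if unsigned_residue q (int l) \<in> unit_residues q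
       then pole_coefficient q s M (int (unsigned_residue q (int l))) else 0)"
  proof (cases "unsigned_residue q (int l) \<in> unit_residues q")
    case True
    show ?thesis unfolding if_P[OF True] by (rule cong)
  next
    case False
    then show ?thesis using multiplicity_at_nonunit[OF False] assms by (simp add: pole_coefficient_def)
  qed
qed

lemma multiplicity_at_le:
  assumes "\<And>c. c \<in> unit_residues q \<Longrightarrow> multiplicity_at q s (int c) \<le> M"
  shows "multiplicity_at q s l \<le> M"
proof (cases "unsigned_residue q l \<in> unit_residues q")
  case True
  have q0: "q > 0" using q by simp
  have "unsigned_residue q l = unsigned_residue q (int (unsigned_residue q l))"
    by (simp add: unsigned_residue_of_nat unsigned_residue_le q0)
  from multiplicity_at_cong[OF q0 this, of s] assms[OF True] show ?thesis by (rule ord_eq_le_trans)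
qed (simp add: multiplicity_at_nonunit)

end

text \<open>It suffices to compare counts on unit classes, as the remaining classes contain no
  parameter on either side.\<close>

lemma isometric_of_residue_counts:
  fixes s :: "int^'n" and t :: "int^'m"
  assumes q: "2 \<le> q" and s: "\<forall>j. coprime (int q) (s $ j)" and t: "\<forall>j. coprime (int q) (t $ j)"
    and l: "coprime q l"
    and eq: "\<And>c. c \<in> unit_residues q \<Longrightarrow>
      (\<Sum>d\<in>unit_residues q. if unsigned_residue q (int l * int d) = c then residue_count q s d else 0) = residue_count q t c"
  shows "isometric (lens_group q s) (lens_group q t)"
proof (rule isometric_lens_groups)
  show q0: "q > 0" using q by simp
  show l': "coprime (int q) (int l)" using l by simp
  fix c
  show "card {j. unsigned_residue q (int l * s $ j) = c} = card {j. unsigned_residue q (t $ j) = c}"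
  proof (cases "c \<in> unit_residues q")
    case True
    then show ?thesis using card_unsigned_residue_mult[OF q s, of "\<lambda>u. u = c" "int l"] eq[OF True]
      by (simp add: residue_count_def)
  next
    case False
    have "unsigned_residue q (int l * s $ j) \<noteq> c" for j
      using unsigned_residue_in_unit_residues[OF q0, of "int l * s $ j"] False l' s by auto
    moreover have "unsigned_residue q (t $ j) \<noteq> c" for j
      using unsigned_residue_in_unit_residues[OF q0, of "t $ j"] False t by auto
    ultimately show ?thesis by simp
  qed
qed

text \<open>With one class the number of blocks is the only datum, and the spectrum determines
  it.\<close>

lemma isospectral_imp_isometric_one_residue:
  fixes s :: "int^'n" and t :: "int^'m"
  assumes q: "2 \<le> q" and s: "\<forall>j. coprime (int q) (s $ j)" and t: "\<forall>j. coprime (int q) (t $ j)"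
    and iso: "isospectral (lens_group q s) (lens_group q t)"
    and C: "unit_residues q = {1}"
  shows "isometric (lens_group q s) (lens_group q t)"
proof (rule isometric_of_residue_counts[OF q s t, of 1])
  fix c assume "c \<in> unit_residues q"
  then show "(\<Sum>d\<in>unit_residues q. if unsigned_residue q (int 1 * int d) = c then residue_count q s d else 0) = residue_count q t c"
    using sum_residue_count[OF q s] sum_residue_count[OF q t] isospectral_imp_CARD_eq[OF _ iso] q
      unsigned_residue_of_nat[of q 1]
    by (simp add: C)
qed simp

text \<open>\<open>C\<close> says that every unit class has exactly two representatives below
  \<open>q\<close>. It holds for q > 2 and is checked by evaluation for each modulus concerned; the
  factor 2 cancels.\<close>

lemma sum_pole_coefficient_eq_of_isospectral:
  fixes s :: "int^'n" and t :: "int^'m"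
  assumes q: "2 \<le> q" and s: "\<forall>j. coprime (int q) (s $ j)" and t: "\<forall>j. coprime (int q) (t $ j)"
    and iso: "isospectral (lens_group q s) (lens_group q t)"
    and C: "\<And>f::nat \<Rightarrow> real. (\<Sum>l<q. if unsigned_residue q (int l) \<in> unit_residues q
        then f (unsigned_residue q (int l)) else 0) = 2 * (\<Sum>c\<in>unit_residues q. f c)"
    and M: "\<And>c. c \<in> unit_residues q \<Longrightarrow> multiplicity_at q s (int c) \<le> M"
      "\<And>c. c \<in> unit_residues q \<Longrightarrow> multiplicity_at q t (int c) \<le> M" "M > 0"
  shows "(\<Sum>c\<in>unit_residues q. pole_coefficient q s M (int c)) =
    (\<Sum>c\<in>unit_residues q. pole_coefficient q t M (int c))"
  using isospectral_imp_sum_pole_coefficient_eq[OF q iso, of M]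
    multiplicity_at_le[OF q s M(1)] multiplicity_at_le[OF q t M(2)]
    sum_pole_coefficient[OF q s M(3)] sum_pole_coefficient[OF q t M(3)]
    C[of "\<lambda>c. pole_coefficient q s M (int c)"] C[of "\<lambda>c. pole_coefficient q t M (int c)"]
  by simp

text \<open>By positivity, M is attained on one side iff on the other; the total then fixes the
  second count.\<close>

lemma two_counts_eq:
  fixes x :: real
  assumes "x > 0" and "a + b = a' + b'" and "a \<le> M" "b \<le> M" "a' \<le> M" "b' \<le> M"
    and "M \<in> {a, b, a', b'}"
    and "(if a = M then x ^ b else 0) + (if b = M then x ^ a else 0) =
      (if a' = M then x ^ b' else 0) + (if b' = M then x ^ a' else 0)"
  shows "a' = a \<and> b' = b \<or> a' = b \<and> b' = a"
proof -
  have "x ^ k > 0" for k using assms(1) by simp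
  then have "(a = M \<or> b = M) \<longleftrightarrow> (a' = M \<or> b' = M)"
    using assms(8) by (smt (verit))
  then show ?thesis using assms(2-7) by auto
qed

lemma isospectral_imp_isometric_two_residues:
  fixes s :: "int^'n" and t :: "int^'m"
  assumes q: "2 \<le> q" and s: "\<forall>j. coprime (int q) (s $ j)" and t: "\<forall>j. coprime (int q) (t $ j)"
    and iso: "isospectral (lens_group q s) (lens_group q t)"
    and C: "unit_residues q = {1, g}" "1 < g" "unsigned_residue q (int g * int g) = 1"
    and sum: "\<And>f::nat \<Rightarrow> real. (\<Sum>l<q. if unsigned_residue q (int l) \<in> unit_residues q
        then f (unsigned_residue q (int l)) else 0) = 2 * (\<Sum>c\<in>unit_residues q. f c)"
  shows "isometric (lens_group q s) (lens_group q t)"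
proof -
  have q0: "q > 0" using q by simp
  have "g \<in> unit_residues q" using C by simp
  then have g: "2 * g \<le> q" "coprime q g" by (simp_all add: unit_residues_def)
  have ur: "unsigned_residue q (int g) = g" "unsigned_residue q 1 = 1"
    using unsigned_residue_of_nat[OF q0 g(1)] unsigned_residue_of_nat[OF q0, of 1] q by simp_all
  let ?a = "residue_count q s 1" and ?b = "residue_count q s g"
  let ?a' = "residue_count q t 1" and ?b' = "residue_count q t g"
  have n: "?a + ?b = CARD('n)" "?a' + ?b' = CARD('m)"
    using sum_residue_count[OF q s] sum_residue_count[OF q t] C by simp_all
  \<comment> \<open>Summand l counts the class inverse to l, and \<open>g\<close> is its own inverse
    up to sign.\<close>
  have m: "multiplicity_at q s 1 = ?a" "multiplicity_at q s (int g) = ?b"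
     "multiplicity_at q t 1 = ?a'" "multiplicity_at q t (int g) = ?b'"
    using C(2) by (simp_all add: multiplicity_at_eq[OF q s] multiplicity_at_eq[OF q t] C ur)
  \<comment> \<open>One bound for both spaces: that the maximal pole orders agree is only a
    consequence of comparing coefficients.\<close>
  define M where "M = Max {?a, ?b, ?a', ?b'}"
  have le: "?a \<le> M" "?b \<le> M" "?a' \<le> M" "?b' \<le> M" unfolding M_def by (auto intro!: Max_ge)
  have mem: "M \<in> {?a, ?b, ?a', ?b'}" unfolding M_def by (rule Max_in) auto
  have "CARD('n) > 0" by simp
  then have "M > 0" using le(1,2) n(1) by linarith
  let ?x = "1 / root_gap q g"
  have p: "pole_coefficient q s M 1 = (if ?a = M then ?x ^ ?b else 0)"
    "pole_coefficient q s M (int g) = (if ?b = M then ?x ^ ?a else 0)"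
    "pole_coefficient q t M 1 = (if ?a' = M then ?x ^ ?b' else 0)"
    "pole_coefficient q t M (int g) = (if ?b' = M then ?x ^ ?a' else 0)"
    using C(2) by (simp_all add: pole_coefficient_eq[OF q s] pole_coefficient_eq[OF q t] C ur m)
  have "multiplicity_at q s (int c) \<le> M" "multiplicity_at q t (int c) \<le> M" if "c \<in> unit_residues q" for c
    using that le unfolding C(1) by (elim insertE; simp add: m)+
  from sum_pole_coefficient_eq_of_isospectral[OF q s t iso sum this \<open>M > 0\<close>]
  have "(\<Sum>c\<in>unit_residues q. pole_coefficient q s M (int c)) =
    (\<Sum>c\<in>unit_residues q. pole_coefficient q t M (int c))" .
  then have "(if ?a = M then ?x ^ ?b else 0) + (if ?b = M then ?x ^ ?a else 0) =
      (if ?a' = M then ?x ^ ?b' else 0) + (if ?b' = M then ?x ^ ?a' else 0)"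
    using C(1,2) p by simp
  moreover have "?x > 0" using root_gap_pos[OF C(2) g(1)] by simp
  moreover have "?a + ?b = ?a' + ?b'" using n isospectral_imp_CARD_eq[OF q0 iso] by simp
  ultimately consider "?a' = ?a" "?b' = ?b" | "?a' = ?b" "?b' = ?a"
    using two_counts_eq[OF _ _ le mem] by blast
  then show ?thesis
  proof cases
    case 1
    then show ?thesis using C(2)
      by (intro isometric_of_residue_counts[OF q s t, of 1]) (auto simp: C ur)
  next
    case 2
    then show ?thesis using C(2)
      by (intro isometric_of_residue_counts[OF q s t g(2)]) (auto simp: C ur)
  qed
qed

text \<open>Without the common factors this is \<open>x ^ (j - i) < y ^ (j - i)\<close>.\<close>

lemma power_mix_less:
  fixes x y :: real
  assumes "x > 0" "y > 0" "x < y" "i < j" "j \<le> k"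
  shows "x ^ j * y ^ (k - j) < x ^ i * y ^ (k - i)"
proof -
  have "x ^ (j - i) < y ^ (j - i)" using assms by (intro power_strict_mono) auto
  then have "x ^ i * x ^ (j - i) * y ^ (k - j) < x ^ i * y ^ (j - i) * y ^ (k - j)"
    using assms by simp
  moreover have "x ^ i * x ^ (j - i) = x ^ j" using assms by (simp flip: power_add)
  moreover have "y ^ (j - i) * y ^ (k - j) = y ^ (k - i)" using assms by (simp flip: power_add)
  ultimately show ?thesis by (simp add: mult.assoc)
qed

text \<open>The first count of both triples is M. Without further maxima, monotonicity of x^b y^(k -
  b) in b gives b' = b; with a tie on both sides the total suffices; a tie on one side only is
  impossible.\<close>

lemma three_counts_eq_normalized:
  fixes x y :: real
  assumes x: "x > 0" and y: "y > 0" and xy: "x \<noteq> y"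
    and sum: "b + c = b' + c'" and le: "b \<le> M" "c \<le> M" "b' \<le> M" "c' \<le> M"
    and eq: "x ^ b * y ^ c + (if b = M then x ^ c * y ^ M else 0) + (if c = M then x ^ M * y ^ b else 0) =
      x ^ b' * y ^ c' + (if b' = M then x ^ c' * y ^ M else 0) + (if c' = M then x ^ M * y ^ b' else 0)"
  shows "b' = b \<and> c' = c \<or> b' = M \<and> c = M \<and> c' = b \<or> c' = M \<and> b = M \<and> b' = c"
proof -
  \<comment> \<open>The expression is strictly monotone in the exponent, so an interior value lies
    below the larger end value.\<close>
  have strict: "x ^ i * y ^ (k - i) < max (x ^ d * y ^ (k - d)) (x ^ e * y ^ (k - e))"
    if "d < i" "i < e" "e \<le> k" for i d e k
  proof (cases "x < y")
    case True
    from power_mix_less[OF x y this that(1), of k] that show ?thesis by (simp add: less_max_iff_disj)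
  next
    case False
    then have "y < x" using xy by simp
    from power_mix_less[OF y x this, of "k - e" "k - i" k] that show ?thesis
      by (simp add: mult.commute less_max_iff_disj)
  qed
  have inj: "i = j" if "x ^ i * y ^ (k - i) = x ^ j * y ^ (k - j)" "i \<le> k" "j \<le> k" for i j k
  proof -
    have "\<not> i < j" if "x ^ i * y ^ (k - i) = x ^ j * y ^ (k - j)" "i \<le> k" "j \<le> k" for i j
    proof
      assume ij: "i < j"
      show False
      proof (cases "x < y")
        case True
        from power_mix_less[OF x y True ij that(3)] that(1) show False by simp
      next
        case False
        then have "y < x" using xy by simp
        moreover have "k - j < k - i" using ij that by linarith
        ultimately show False
          using power_mix_less[OF y x, of "k - j" "k - i" k] that by (simp add: mult.commute)
      qed
    qed
    from this[of i j] this[of j i] that show ?thesis by (simp add: linorder_neq_iff not_less)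
  qed
  \<comment> \<open>A tie contributes both end values x^d y^M and x^M y^d with d = k - M. The single
    term on the other side has its exponent strictly between d and M and is too small.\<close>
  have key: False
    if b: "b + c = b' + c'" "b < M" "c < M" "b' = M \<or> c' = M" "b' \<le> M" "c' \<le> M"
      and eq: "x ^ b * y ^ c = x ^ b' * y ^ c' + (if b' = M then x ^ c' * y ^ M else 0) + (if c' = M then x ^ M * y ^ b' else 0)"
    for b c b' c'
  proof -
    define k where "k = b + c"
    define d where "d = k - M"
    have d: "d < b" "b < M" "M \<le> k" "k - d = M" "k - b = c" "k - M = d"
      using b by (auto simp: k_def d_def)
    have pos: "x ^ i * y ^ j > 0" for i j using x y by simp
    have "x ^ b * y ^ c \<ge> x ^ d * y ^ M + x ^ M * y ^ d"
    proof -
      have "b' = M \<and> c' = d \<or> c' = M \<and> b' = d" using b by (auto simp: k_def d_def)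
      then show ?thesis using eq pos[of d M] pos[of M d] pos[of b' c'] by (auto split: if_splits)
    qed
    moreover have "x ^ b * y ^ c < max (x ^ d * y ^ M) (x ^ M * y ^ d)"
      using strict[OF d(1-3)] by (simp only: d(4-6))
    ultimately show False using pos[of d M] pos[of M d] by linarith
  qed
  consider "b < M" "c < M" "b' < M" "c' < M" | "b < M" "c < M" "b' = M \<or> c' = M"
    | "b = M \<or> c = M" "b' < M" "c' < M" | "b = M \<or> c = M" "b' = M \<or> c' = M"
    using le by linarith
  then show ?thesis
  proof cases
    case 1
    moreover have "b + c - b = c" "b + c - b' = c'" using sum by simp_all
    ultimately have "x ^ b * y ^ (b + c - b) = x ^ b' * y ^ (b + c - b')" using eq by simp
    from inj[OF this] sum show ?thesis by auto
  next
    case 2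
    then show ?thesis using key[OF sum _ _ _ le(3,4)] eq by auto
  next
    case 3
    then show ?thesis using key[OF sum[symmetric] _ _ _ le(1,2)] eq by auto
  next
    case 4
    then show ?thesis using sum by auto
  qed
qed

text \<open>\<open>V\<close> is invariant under cyclic rotation of the counts, which corresponds to
  scaling the parameters by a unit. Rotating both triples to begin with M gives the normalized
  case.\<close>

lemma three_counts_eq:
  fixes x y :: real
  defines "V \<equiv> \<lambda>M a b c. (if a = M then x ^ b * y ^ c else 0) + (if b = M then x ^ c * y ^ a else 0) +
      (if c = M then x ^ a * y ^ b else 0)"
  assumes x: "x > 0" and y: "y > 0" and xy: "x \<noteq> y"
    and sum: "a + b + c = a' + b' + c'"
    and le: "a \<le> M" "b \<le> M" "c \<le> M" "a' \<le> M" "b' \<le> M" "c' \<le> M"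
    and mem: "M \<in> {a, b, c, a', b', c'}"
    and eq: "V M a b c = V M a' b' c'"
  shows "(a', b', c') \<in> {(a, b, c), (b, c, a), (c, a, b)}"
proof -
  have norm: "(M, b', c') \<in> {(M, b, c), (b, c, M), (c, M, b)}"
    if "M + b + c = M + b' + c'" "b \<le> M" "c \<le> M" "b' \<le> M" "c' \<le> M" "V M M b c = V M M b' c'" for b c b' c'
    using three_counts_eq_normalized[OF x y xy _ that(2-5)] that(1,6) by (auto simp: V_def)
  have rot: "V M a b c = V M b c a" for a b c by (simp add: V_def)
  have pos: "x ^ i * y ^ j > 0" for i j using x y by simp
  have V_pos: "V M a b c > 0 \<longleftrightarrow> a = M \<or> b = M \<or> c = M" for a b c
    unfolding V_def using pos[of b c] pos[of c a] pos[of a b] by auto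
  have att: "a = M \<or> b = M \<or> c = M" "a' = M \<or> b' = M \<or> c' = M"
    using mem V_pos[of a b c] V_pos[of a' b' c'] eq by auto
  then obtain u v w u' v' w' where
    uvw: "(u, v, w) \<in> {(a, b, c), (b, c, a), (c, a, b)}" "u = M"
      "(u', v', w') \<in> {(a', b', c'), (b', c', a'), (c', a', b')}" "u' = M"
    by blast
  have "V M u v w = V M a b c" using uvw(1) rot[of a b c] rot[of b c a] by auto
  moreover have "V M u' v' w' = V M a' b' c'" using uvw(3) rot[of a' b' c'] rot[of b' c' a'] by auto
  ultimately have V: "V M u v w = V M u' v' w'" using eq by (simp only:)
  have "(u', v', w') \<in> {(u, v, w), (v, w, u), (w, u, v)}"
  proof -
    have "u + v + w = a + b + c" "v \<le> M" "w \<le> M" using uvw(1) le(1-3) by auto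
    moreover have "u' + v' + w' = a' + b' + c'" "v' \<le> M" "w' \<le> M" using uvw(3) le(4-6) by auto
    ultimately show ?thesis using norm[of v w v' w'] V sum unfolding uvw(2,4) by (simp only:)
  qed
  then show ?thesis using uvw(1,3) by (elim insertE emptyE; simp)
qed

lemma isospectral_imp_isometric_three_residues:
  fixes s :: "int^'n" and t :: "int^'m"
  assumes q: "2 \<le> q" and s: "\<forall>j. coprime (int q) (s $ j)" and t: "\<forall>j. coprime (int q) (t $ j)"
    and iso: "isospectral (lens_group q s) (lens_group q t)"
    and C: "unit_residues q = {1, g, h}" "1 < g" "1 < h" "g \<noteq> h"
    and mult: "unsigned_residue q (int g * int g) = h" "unsigned_residue q (int g * int h) = 1"
      "unsigned_residue q (int h * int h) = g"
    and sum: "\<And>f::nat \<Rightarrow> real. (\<Sum>l<q. if unsigned_residue q (int l) \<in> unit_residues q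
        then f (unsigned_residue q (int l)) else 0) = 2 * (\<Sum>c\<in>unit_residues q. f c)"
  shows "isometric (lens_group q s) (lens_group q t)"
proof -
  have q0: "q > 0" using q by simp
  have "g \<in> unit_residues q" "h \<in> unit_residues q" using C(1) by simp_all
  then have g: "2 * g \<le> q" "coprime q g" and h: "2 * h \<le> q" "coprime q h"
    by (simp_all add: unit_residues_def)
  have ur: "unsigned_residue q (int g) = g" "unsigned_residue q (int h) = h" "unsigned_residue q 1 = 1"
    using unsigned_residue_of_nat[OF q0 g(1)] unsigned_residue_of_nat[OF q0 h(1)]
      unsigned_residue_of_nat[OF q0, of 1] q by simp_all
  have mult': "unsigned_residue q (int h * int g) = 1" using mult(2) by (simp add: mult.commute)
  let ?a = "residue_count q s 1" and ?b = "residue_count q s g" and ?c = "residue_count q s h"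
  let ?a' = "residue_count q t 1" and ?b' = "residue_count q t g" and ?c' = "residue_count q t h"
  have n: "?a + ?b + ?c = CARD('n)" "?a' + ?b' + ?c' = CARD('m)"
    using sum_residue_count[OF q s] sum_residue_count[OF q t] C by simp_all
  \<comment> \<open>Summand l counts the class inverse to l; \<open>g\<close> and \<open>h\<close>
    are mutually inverse up to sign, hence the exchange of \<open>?b\<close> and
    \<open>?c\<close>.\<close>
  have m: "multiplicity_at q s 1 = ?a" "multiplicity_at q s (int g) = ?c" "multiplicity_at q s (int h) = ?b"
     "multiplicity_at q t 1 = ?a'" "multiplicity_at q t (int g) = ?c'" "multiplicity_at q t (int h) = ?b'"
    using C by (simp_all add: multiplicity_at_eq[OF q s] multiplicity_at_eq[OF q t] ur mult mult')
  define M where "M = Max {?a, ?b, ?c, ?a', ?b', ?c'}"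
  have le: "?a \<le> M" "?b \<le> M" "?c \<le> M" "?a' \<le> M" "?b' \<le> M" "?c' \<le> M"
    unfolding M_def by (auto intro!: Max_ge)
  have mem: "M \<in> {?a, ?b, ?c, ?a', ?b', ?c'}" unfolding M_def by (rule Max_in) auto
  have "CARD('n) > 0" by simp
  then have "M > 0" using le(1-3) n(1) by linarith
  let ?x = "1 / root_gap q g" and ?y = "1 / root_gap q h"
  have p: "pole_coefficient q s M 1 = (if ?a = M then ?x ^ ?b * ?y ^ ?c else 0)"
    "pole_coefficient q s M (int g) = (if ?c = M then ?x ^ ?a * ?y ^ ?b else 0)"
    "pole_coefficient q s M (int h) = (if ?b = M then ?x ^ ?c * ?y ^ ?a else 0)"
    "pole_coefficient q t M 1 = (if ?a' = M then ?x ^ ?b' * ?y ^ ?c' else 0)"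
    "pole_coefficient q t M (int g) = (if ?c' = M then ?x ^ ?a' * ?y ^ ?b' else 0)"
    "pole_coefficient q t M (int h) = (if ?b' = M then ?x ^ ?c' * ?y ^ ?a' else 0)"
    using C(2-4)
    by (simp_all add: pole_coefficient_eq[OF q s] pole_coefficient_eq[OF q t] C(1) ur m mult mult' mult.commute)
  have "multiplicity_at q s (int c) \<le> M" "multiplicity_at q t (int c) \<le> M" if "c \<in> unit_residues q" for c
    using that le unfolding C(1) by (elim insertE; simp add: m)+
  from sum_pole_coefficient_eq_of_isospectral[OF q s t iso sum this \<open>M > 0\<close>]
  have "(\<Sum>c\<in>unit_residues q. pole_coefficient q s M (int c)) =
    (\<Sum>c\<in>unit_residues q. pole_coefficient q t M (int c))" .
  then have eq: "(if ?a = M then ?x ^ ?b * ?y ^ ?c else 0) + (if ?b = M then ?x ^ ?c * ?y ^ ?a else 0) +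
      (if ?c = M then ?x ^ ?a * ?y ^ ?b else 0) =
    (if ?a' = M then ?x ^ ?b' * ?y ^ ?c' else 0) + (if ?b' = M then ?x ^ ?c' * ?y ^ ?a' else 0) +
      (if ?c' = M then ?x ^ ?a' * ?y ^ ?b' else 0)"
    using C(2-4) by (simp add: C(1) p add_ac del: power_one_over)
  have pos: "root_gap q g > 0" "root_gap q h > 0"
    using root_gap_pos C(2,3) g(1) h(1) by simp_all
  \<comment> \<open>Distinct classes have distinct gaps, which lets the coefficient tell
    \<open>?b\<close> from \<open>?c\<close>.\<close>
  have "root_gap q g \<noteq> root_gap q h"
    using root_gap_strict_mono[OF _ g(1), of h] root_gap_strict_mono[OF _ h(1), of g] C(4)
    by (metis less_irrefl nat_neq_iff)
  then have "?x \<noteq> ?y" using pos by simp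
  moreover have "?a + ?b + ?c = ?a' + ?b' + ?c'" using n isospectral_imp_CARD_eq[OF q0 iso] by simp
  ultimately have "(?a', ?b', ?c') \<in> {(?a, ?b, ?c), (?b, ?c, ?a), (?c, ?a, ?b)}"
    using pos by (intro three_counts_eq[OF _ _ _ _ le mem eq]) simp_all
  then consider "?a' = ?a" "?b' = ?b" "?c' = ?c" | "?a' = ?b" "?b' = ?c" "?c' = ?a" | "?a' = ?c" "?b' = ?a" "?c' = ?b"
    by auto
  then show ?thesis
  proof cases
    case 1
    then show ?thesis using C(2-4)
      by (intro isometric_of_residue_counts[OF q s t, of 1]) (auto simp: C(1) ur)
  next
    \<comment> \<open>Multiplication by \<open>h\<close> sends the classes g, h, 1 to 1, g, h, which
      is this rotation; \<open>g\<close> gives the other one.\<close>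
    case 2
    then show ?thesis using C(2-4)
      by (intro isometric_of_residue_counts[OF q s t h(2)]) (auto simp: C(1) ur mult mult')
  next
    case 3
    then show ?thesis using C(2-4)
      by (intro isometric_of_residue_counts[OF q s t g(2)]) (auto simp: C(1) ur mult mult')
  qed
qed

text \<open>A filter of a bounded set, which evaluation can compute.\<close>

lemma unit_residues_eq_filter: "unit_residues q = Set.filter (coprime q) {..q div 2}"
  by (auto simp: unit_residues_def)

lemma unit_residues_values:
  "unit_residues 2 = {1}" "unit_residues 3 = {1}" "unit_residues 4 = {1}" "unit_residues 6 = {1}"
  "unit_residues 5 = {1, 2}" "unit_residues 8 = {1, 3}" "unit_residues 10 = {1, 3}"
  "unit_residues 7 = {1, 2, 3}" "unit_residues 9 = {1, 2, 4}"
  unfolding unit_residues_eq_filter by code_simp+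

theorem theorem3p2:
  fixes q :: nat and s :: "int^'n" and t :: "int^'m"
  assumes "1 \<le> q" and "q \<le> 10"
    and "\<forall>j. coprime (int q) (s $ j)"
    and "\<forall>j. coprime (int q) (t $ j)"
    and "isospectral (lens_group q s) (lens_group q t)"
  shows "isometric (lens_group q s) (lens_group q t)"
proof -
  have "q = 1 \<or> q = 2 \<or> q = 3 \<or> q = 4 \<or> q = 5 \<or> q = 6 \<or> q = 7 \<or> q = 8 \<or> q = 9 \<or> q = 10"
    using assms(1,2) by arith
  then consider "q = 1" | "q = 2" | "q = 3" | "q = 4" | "q = 5" | "q = 6" | "q = 7" | "q = 8" | "q = 9" | "q = 10"
    by blast
  then show ?thesis
  proof cases
    case 1
    \<comment> \<open>All parameters are congruent modulo 1, so equal numbers of blocks suffice,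
      with scaling unit 1.\<close>
    have "unsigned_residue 1 c = 0" for c by (simp add: unsigned_residue_def)
    then show ?thesis
      using isospectral_imp_CARD_eq[OF _ assms(5)] 1 by (intro isometric_lens_groups[of _ 1]) simp_all
  next
    case 2
    show ?thesis
      by (rule isospectral_imp_isometric_one_residue[OF _ assms(3-5)]) (simp_all add: 2 unit_residues_values)
  next
    case 3
    show ?thesis
      by (rule isospectral_imp_isometric_one_residue[OF _ assms(3-5)]) (simp_all add: 3 unit_residues_values)
  next
    case 4
    show ?thesis
      by (rule isospectral_imp_isometric_one_residue[OF _ assms(3-5)]) (simp_all add: 4 unit_residues_values)
  next
    case 5
    \<comment> \<open>The class of 2 is its own inverse as 2^2 = -1 modulo 5; for 8 and 10 below,
      3^2 is 1 and -1.\<close>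
    show ?thesis
      by (rule isospectral_imp_isometric_two_residues[OF _ assms(3-5), of 2])
        (simp_all add: 5 unit_residues_values unsigned_residue_def lessThan_nat_numeral lessThan_Suc)
  next
    case 6
    show ?thesis
      by (rule isospectral_imp_isometric_one_residue[OF _ assms(3-5)]) (simp_all add: 6 unit_residues_values)
  next
    case 7
    \<comment> \<open>Up to sign, 2^2 = 3, 2 * 3 = 1 and 3^2 = 2 modulo 7; for 9 below, 2^2 = 4, 2 *
      4 = 1 and 4^2 = 2.\<close>
    show ?thesis
      by (rule isospectral_imp_isometric_three_residues[OF _ assms(3-5), of 2 3])
        (simp_all add: 7 unit_residues_values unsigned_residue_def lessThan_nat_numeral lessThan_Suc)
  next
    case 8
    show ?thesis
      by (rule isospectral_imp_isometric_two_residues[OF _ assms(3-5), of 3])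
        (simp_all add: 8 unit_residues_values unsigned_residue_def lessThan_nat_numeral lessThan_Suc)
  next
    case 9
    show ?thesis
      by (rule isospectral_imp_isometric_three_residues[OF _ assms(3-5), of 2 4])
        (simp_all add: 9 unit_residues_values unsigned_residue_def lessThan_nat_numeral lessThan_Suc)
  next
    case 10
    show ?thesis
      by (rule isospectral_imp_isometric_two_residues[OF _ assms(3-5), of 3])
        (simp_all add: 10 unit_residues_values unsigned_residue_def lessThan_nat_numeral lessThan_Suc)
  qed
qed

end
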